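(* For disjoint finite sets $M$ (men) and $W$ (women) with $|M|\ge 3$ and $|W|\ge 3$, let $\bar q$ be drawn uniformly at random from $\mathcal P(M)^W$ (the preference profiles for $W$ over $M$). Then: (a) For every $\varepsilon>0$ there is $N$ such that whenever $|M|,|W|\ge 3$ and $|M|+|W|\ge N$, with probability at least $1-\varepsilon$ no $\bar q$-stable (one-side-querying) matching rule is OSP-implementable. (b) For every $\varepsilon>0$ there is $N$ such that whenever $|M|\ge 3$, $|W|\ge 3$ and $|W|\ge N$, for every three distinct men $a,b,c\in M$, with probability at least $1-\varepsilon$ no $\bar q$-stable (one-side-querying) matching mechanism is OSP for $a$, $b$, and $c$ (i.e. for all three of them). (c) For every polynomial $f$ and every $\varepsilon>0$ there is $N$ such that whenever $|M|,|W|\ge 3$, $|M|\le f(|W|)$ and $|M|+|W|\ge N$, with probability at least $1-\varepsilon$ no $\bar q$-stable (one-side-querying) matching mechanism is OSP for more than two men.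
   Context: A preference list (for a man) over $W$ is a totally ordered subset of $W$; women not on the list are unacceptable. $\mathcal P(W)$ is the set of all preference lists over $W$; $\mathcal P(M)$ is defined analogously for women's lists over $M$. Profiles: $\bar p=(p_m)_{m\in M}\in\mathcal P(W)^M$ and $\bar q=(q_w)_{w\in W}\in\mathcal P(M)^W$. Given $p_m$, write $w\succ_m w'$ if $w$ is ranked higher than $w'$ on $p_m$, or $w$ is on $p_m$ and $w'$ is not; being unmatched counts as an outcome not on the list, so every listed woman is strictly preferred to being unmatched. Write $w\succeq_m w'$ if not $w'\succ_m w$. Similarly for women. A matching is a one-to-one mapping between a subset of $M$ and a subset of $W$; $\mathcal M$ is the set of matchings; $\mu_a$ is the match of participant $a$ in $\mu$, with $\mu_a=a$ if $a$ is unmatched. A matching $\mu$ is unstable with respect to $\bar p,\bar q$ if there are a man $m$ and a woman $w$ each preferring the other over what $\mu$ gives them, or some participant is matched with someone not on his or her preference list; otherwise $\mu$ is stable. A (one-side-querying) matching rule is a function $C:\mathcal P(W)^M\to\mathcal M$; $C_m(\bar p)$ denotes the match of $m$ in $C(\bar p)$. It is $\bar q$-stable if for every $\bar p\in\mathcal P(W)^M$ the matching $C(\bar p)$ is stable with respect to $\bar p$ and $\bar q$. A (one-side-querying, extensive-form) matching mechanism $\mathcal I$ consists of: (1) a finite rooted tree $T$ with edges directed away from the root; (2) a map $X$ from leaves of $T$ to $\mathcal M$; (3) a map $Q$ from internal nodes of $T$ to $M$; (4) a map $A$ from edges of $T$ to nonempty subsets of $\mathcal P(W)$ such that the sets on distinct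 edges outgoing from the same node are disjoint, and the union of the sets on the edges outgoing from a node $n$ equals the set $A(e)$ for the last edge $e$, along the path from the root to $n$, that is outgoing from a node $n'$ with $Q(n')=Q(n)$, or equals $\mathcal P(W)$ if there is no such edge. A profile $\bar p\in\mathcal P(W)^M$ passes through a node $n$ if for every edge $e$ on the path from the root to $n$, with source node $n'$, $p_{Q(n')}\in A(e)$. The matching rule $C^{\mathcal I}$ implemented by $\mathcal I$ maps $\bar p$ to $X(n)$, where $n$ is the unique leaf through which $\bar p$ passes. $\mathcal I$ is $\bar q$-stable if $C^{\mathcal I}$ is. Two lists $p,p'$ diverge at a node $n$ if there are distinct edges $e,e'$ outgoing from $n$ with $p\in A(e)$, $p'\in A(e')$. $\mathcal I$ is obviously strategy-proof (OSP) for $m\in M$ if for every node $n$ with $Q(n)=m$ and all profiles $\bar p,\bar p'$ that both pass through $n$ such that $p_m$ and $p'_m$ diverge at $n$, $C^{\mathcal I}_m(\bar p)\succeq_m C^{\mathcal I}_m(\bar p')$ according to $p_m$. $\mathcal I$ is OSP if it is OSP for every $m\in M$. A matching rule $C$ is OSP-implementable if $C=C^{\mathcal I}$ for some OSP matching mechanism $\mathcal I$. *)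

theory Defs
  imports "HOL-Probability.Probability" "HOL-Computational_Algebra.Polynomial" "HOL-Library.Sublist"
begin

text \<open>
  Men and women have types \<^typ>\<open>'m\<close> and \<^typ>\<open>'w\<close>. Using two types takes care of the disjointness
  of the two sides.
\<close>

section \<open>Preference lists and matchings\<close>

text \<open>
  For a finite set \<open>X\<close>, totally ordered subsets of \<open>X\<close> correspond to duplicate-free lists of elements
  of \<open>X\<close>, with the most preferred element first.
\<close>

definition pref_lists :: "'a set \<Rightarrow> 'a list set" where
  "pref_lists X = {xs. distinct xs \<and> set xs \<subseteq> X}"

definition profiles :: "'i set \<Rightarrow> 'a set \<Rightarrow> ('i \<Rightarrow> 'a list) set" where
  "profiles I X = (\<Pi>\<^sub>E i\<in>I. pref_lists X)"

definition ranked_higher :: "'a list \<Rightarrow> 'a \<Rightarrow> 'a \<Rightarrow> bool" where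
  "ranked_higher xs x y \<longleftrightarrow> (\<exists>i j. i < j \<and> j < length xs \<and> xs ! i = x \<and> xs ! j = y)"

text \<open>
  An outcome of a participant is the partner, or \<^const>\<open>None\<close> if unmatched; \<^const>\<open>None\<close> is never
  on a list.
\<close>

definition on_list :: "'a option \<Rightarrow> 'a list \<Rightarrow> bool" where
  "on_list u xs \<longleftrightarrow> u \<in> Some ` set xs"

definition prefers :: "'a list \<Rightarrow> 'a option \<Rightarrow> 'a option \<Rightarrow> bool" where
  "prefers xs u v \<longleftrightarrow>
     (\<exists>x y. u = Some x \<and> v = Some y \<and> ranked_higher xs x y) \<or> (on_list u xs \<and> \<not> on_list v xs)"

definition weakly_prefers :: "'a list \<Rightarrow> 'a option \<Rightarrow> 'a option \<Rightarrow> bool" where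
  "weakly_prefers xs u v \<longleftrightarrow> \<not> prefers xs v u"

type_synonym ('m, 'w) matching = "'m \<Rightarrow> 'w option"

definition matchings :: "'m set \<Rightarrow> 'w set \<Rightarrow> ('m, 'w) matching set" where
  "matchings M W = {\<mu>. dom \<mu> \<subseteq> M \<and> ran \<mu> \<subseteq> W \<and> inj_on \<mu> (dom \<mu>)}"

definition match_of_woman :: "('m, 'w) matching \<Rightarrow> 'w \<Rightarrow> 'm option" where
  "match_of_woman \<mu> w =
     (if \<exists>m. \<mu> m = Some w then Some (THE m. \<mu> m = Some w) else None)"

definition unstable ::
  "'m set \<Rightarrow> 'w set \<Rightarrow> ('m \<Rightarrow> 'w list) \<Rightarrow> ('w \<Rightarrow> 'm list) \<Rightarrow> ('m, 'w) matching \<Rightarrow> bool" where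
  "unstable M W p q \<mu> \<longleftrightarrow>
     (\<exists>m\<in>M. \<exists>w\<in>W. prefers (p m) (Some w) (\<mu> m) \<and> prefers (q w) (Some m) (match_of_woman \<mu> w)) \<or>
     (\<exists>m\<in>M. \<mu> m \<noteq> None \<and> \<not> on_list (\<mu> m) (p m)) \<or>
     (\<exists>w\<in>W. match_of_woman \<mu> w \<noteq> None \<and> \<not> on_list (match_of_woman \<mu> w) (q w))"

definition stable ::
  "'m set \<Rightarrow> 'w set \<Rightarrow> ('m \<Rightarrow> 'w list) \<Rightarrow> ('w \<Rightarrow> 'm list) \<Rightarrow> ('m, 'w) matching \<Rightarrow> bool" where
  "stable M W p q \<mu> \<longleftrightarrow> \<not> unstable M W p q \<mu>"


section \<open>Matching rules\<close>

type_synonym ('m, 'w) rule = "('m \<Rightarrow> 'w list) \<Rightarrow> ('m, 'w) matching"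

definition matching_rule :: "'m set \<Rightarrow> 'w set \<Rightarrow> ('m, 'w) rule \<Rightarrow> bool" where
  "matching_rule M W C \<longleftrightarrow> C \<in> profiles M W \<rightarrow> matchings M W"

definition stable_rule ::
  "'m set \<Rightarrow> 'w set \<Rightarrow> ('w \<Rightarrow> 'm list) \<Rightarrow> ('m, 'w) rule \<Rightarrow> bool" where
  "stable_rule M W q C \<longleftrightarrow> (\<forall>p\<in>profiles M W. stable M W p q (C p))"


section \<open>Extensive-form matching mechanisms\<close>

text \<open>
  The nodes of the tree are addresses: the root is \<open>[]\<close> and the children of \<open>n\<close> are the nodes of the
  form \<open>n @ [i]\<close>. Every finite rooted tree arises in this way up to isomorphism. Since every node other
  than the root has exactly one incoming edge, an edge is identified with its target. The ancestors of
  \<open>n\<close> are the nodes \<open>take k n\<close>, \<open>k < length n\<close>, and the edge leaving \<open>take k n\<close> on the path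
  to \<open>n\<close> is \<open>take (Suc k) n\<close>.
\<close>

record ('m, 'w) mechanism =
  nodes :: "nat list set"
  leaf_outcome :: "nat list \<Rightarrow> ('m, 'w) matching"
  queried :: "nat list \<Rightarrow> 'm"
  answers :: "nat list \<Rightarrow> 'w list set"

definition rooted_tree :: "nat list set \<Rightarrow> bool" where
  "rooted_tree T \<longleftrightarrow> finite T \<and> [] \<in> T \<and> (\<forall>n i. n @ [i] \<in> T \<longrightarrow> n \<in> T)"

definition out_edges :: "('m, 'w) mechanism \<Rightarrow> nat list \<Rightarrow> nat list set" where
  "out_edges \<I> n = {e \<in> nodes \<I>. \<exists>i. e = n @ [i]}"

definition internal :: "('m, 'w) mechanism \<Rightarrow> nat list \<Rightarrow> bool" where
  "internal \<I> n \<longleftrightarrow> n \<in> nodes \<I> \<and> out_edges \<I> n \<noteq> {}"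

definition leaf :: "('m, 'w) mechanism \<Rightarrow> nat list \<Rightarrow> bool" where
  "leaf \<I> n \<longleftrightarrow> n \<in> nodes \<I> \<and> out_edges \<I> n = {}"

text \<open>The lists of the man queried at \<open>n\<close> that are consistent with his earlier answers.\<close>

definition available :: "'w set \<Rightarrow> ('m, 'w) mechanism \<Rightarrow> nat list \<Rightarrow> 'w list set" where
  "available W \<I> n =
     (let K = {k. k < length n \<and> queried \<I> (take k n) = queried \<I> n}
      in if K = {} then pref_lists W else answers \<I> (take (Suc (Max K)) n))"

definition matching_mechanism :: "'m set \<Rightarrow> 'w set \<Rightarrow> ('m, 'w) mechanism \<Rightarrow> bool" where
  "matching_mechanism M W \<I> \<longleftrightarrow>
     rooted_tree (nodes \<I>) \<and>
     (\<forall>n. leaf \<I> n \<longrightarrow> leaf_outcome \<I> n \<in> matchings M W) \<and>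
     (\<forall>n. internal \<I> n \<longrightarrow> queried \<I> n \<in> M) \<and>
     (\<forall>n. \<forall>e\<in>out_edges \<I> n. answers \<I> e \<noteq> {} \<and> answers \<I> e \<subseteq> pref_lists W) \<and>
     (\<forall>n. internal \<I> n \<longrightarrow>
        disjoint_family_on (answers \<I>) (out_edges \<I> n) \<and>
        (\<Union>e\<in>out_edges \<I> n. answers \<I> e) = available W \<I> n)"

definition passes :: "('m, 'w) mechanism \<Rightarrow> ('m \<Rightarrow> 'w list) \<Rightarrow> nat list \<Rightarrow> bool" where
  "passes \<I> p n \<longleftrightarrow> (\<forall>k<length n. p (queried \<I> (take k n)) \<in> answers \<I> (take (Suc k) n))"

definition implemented_rule :: "('m, 'w) mechanism \<Rightarrow> ('m, 'w) rule" where
  "implemented_rule \<I> p = leaf_outcome \<I> (THE n. leaf \<I> n \<and> passes \<I> p n)"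

definition stable_mechanism ::
  "'m set \<Rightarrow> 'w set \<Rightarrow> ('w \<Rightarrow> 'm list) \<Rightarrow> ('m, 'w) mechanism \<Rightarrow> bool" where
  "stable_mechanism M W q \<I> \<longleftrightarrow> stable_rule M W q (implemented_rule \<I>)"

definition diverge :: "('m, 'w) mechanism \<Rightarrow> nat list \<Rightarrow> 'w list \<Rightarrow> 'w list \<Rightarrow> bool" where
  "diverge \<I> n xs ys \<longleftrightarrow>
     (\<exists>e\<in>out_edges \<I> n. \<exists>e'\<in>out_edges \<I> n. e \<noteq> e' \<and> xs \<in> answers \<I> e \<and> ys \<in> answers \<I> e')"

definition OSP_for :: "'m set \<Rightarrow> 'w set \<Rightarrow> ('m, 'w) mechanism \<Rightarrow> 'm \<Rightarrow> bool" where
  "OSP_for M W \<I> m \<longleftrightarrow>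
     (\<forall>n p p'. internal \<I> n \<and> queried \<I> n = m \<and> p \<in> profiles M W \<and> p' \<in> profiles M W \<and>
        passes \<I> p n \<and> passes \<I> p' n \<and> diverge \<I> n (p m) (p' m) \<longrightarrow>
        weakly_prefers (p m) (implemented_rule \<I> p m) (implemented_rule \<I> p' m))"

definition OSP :: "'m set \<Rightarrow> 'w set \<Rightarrow> ('m, 'w) mechanism \<Rightarrow> bool" where
  "OSP M W \<I> \<longleftrightarrow> (\<forall>m\<in>M. OSP_for M W \<I> m)"

definition OSP_implementable :: "'m set \<Rightarrow> 'w set \<Rightarrow> ('m, 'w) rule \<Rightarrow> bool" where
  "OSP_implementable M W C \<longleftrightarrow>
     (\<exists>\<I>. matching_mechanism M W \<I> \<and> OSP M W \<I> \<and> (\<forall>p\<in>profiles M W. C p = implemented_rule \<I> p))"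

text \<open>The following facts justify the definite descriptions above.\<close>

lemma match_of_woman_eq:
  assumes "\<mu> \<in> matchings M W" "\<mu> m = Some w"
  shows "match_of_woman \<mu> w = Some m"
proof -
  have inj: "inj_on \<mu> (dom \<mu>)" using assms(1) by (simp add: matchings_def)
  have unique: "m' = m" if "\<mu> m' = Some w" for m'
    by (rule inj_onD[OF inj]) (simp_all add: that assms(2) dom_def)
  have "(THE m. \<mu> m = Some w) = m" using assms(2) unique by (rule the_equality)
  moreover have "\<exists>m. \<mu> m = Some w" using assms(2) ..
  ultimately show ?thesis by (simp only: match_of_woman_def if_True)
qed

lemma ex1_leaf:
  assumes I: "matching_mechanism M W \<I>" and p: "p \<in> profiles M W"
  shows "\<exists>!n. leaf \<I> n \<and> passes \<I> p n"
proof -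
  have tree: "rooted_tree (nodes \<I>)" using I by (simp add: matching_mechanism_def)
  have prefix_closed: "xs \<in> nodes \<I>" if "xs @ ys \<in> nodes \<I>" for xs ys
    using that
  proof (induction ys rule: rev_induct)
    case (snoc y ys)
    then show ?case using tree unfolding rooted_tree_def by (metis append.assoc)
  qed simp
  have ex: "\<exists>n. leaf \<I> n \<and> passes \<I> p n"
  proof -
    let ?S = "{n \<in> nodes \<I>. passes \<I> p n}"
    have fin: "finite ?S" and ne: "?S \<noteq> {}"
      using tree by (auto simp: rooted_tree_def passes_def)
    have "Max (length ` ?S) \<in> length ` ?S" using fin ne by (intro Max_in) auto
    then obtain n where n: "n \<in> ?S" "length n = Max (length ` ?S)" by force
    have max: "length k \<le> length n" if "k \<in> ?S" for k
      unfolding n(2) using fin that by (intro Max_ge) auto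
    have "leaf \<I> n"
    proof (rule ccontr)
      assume "\<not> leaf \<I> n"
      then have int: "internal \<I> n" using n(1) by (auto simp: leaf_def internal_def)
      let ?K = "{k. k < length n \<and> queried \<I> (take k n) = queried \<I> n}"
      have "p (queried \<I> n) \<in> available W \<I> n"
      proof (cases "?K = {}")
        case True
        have "queried \<I> n \<in> M" using I int by (simp add: matching_mechanism_def)
        with True p show ?thesis
          by (auto simp: available_def profiles_def Let_def)
      next
        case False
        have "finite ?K" by simp
        from Max_in[OF this False]
        have K: "Max ?K < length n" "queried \<I> (take (Max ?K) n) = queried \<I> n" by blast+
        have "passes \<I> p n" using n(1) by blast
        with K(1) have "p (queried \<I> (take (Max ?K) n)) \<in> answers \<I> (take (Suc (Max ?K)) n)"
          unfolding passes_def by blast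
        then have "p (queried \<I> n) \<in> answers \<I> (take (Suc (Max ?K)) n)" unfolding K(2) .
        then show ?thesis unfolding available_def Let_def if_not_P[OF False] .
      qed
      moreover have "(\<Union>e\<in>out_edges \<I> n. answers \<I> e) = available W \<I> n"
        using I int by (simp add: matching_mechanism_def)
      ultimately obtain e where "e \<in> out_edges \<I> n" "p (queried \<I> n) \<in> answers \<I> e"
        by blast
      then obtain i where i: "n @ [i] \<in> nodes \<I>" "p (queried \<I> n) \<in> answers \<I> (n @ [i])"
        unfolding out_edges_def by blast
      then have "n @ [i] \<in> ?S" using n(1) by (auto simp: passes_def less_Suc_eq)
      from max[OF this] show False by simp
    qed
    then show ?thesis using n(1) by blast
  qed
  have no_prefix: "\<not> strict_prefix a b" if "leaf \<I> a" "b \<in> nodes \<I>" for a b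
  proof
    assume "strict_prefix a b"
    then obtain i zs where "b = (a @ [i]) @ zs" by (auto elim: strict_prefixE')
    then have "a @ [i] \<in> nodes \<I>" using prefix_closed that by blast
    then show False using that by (auto simp: leaf_def out_edges_def)
  qed
  have "a = b" if a: "leaf \<I> a" "passes \<I> p a" and b: "leaf \<I> b" "passes \<I> p b" for a b
  proof (rule ccontr)
    assume "a \<noteq> b"
    have T: "a \<in> nodes \<I>" "b \<in> nodes \<I>" using a b by (auto simp: leaf_def)
    have "a \<parallel> b" using no_prefix[OF a(1) T(2)] no_prefix[OF b(1) T(1)] \<open>a \<noteq> b\<close>
      by (auto simp: parallel_def strict_prefix_def)
    then obtain c i as j bs where d: "i \<noteq> j" "a = c @ i # as" "b = c @ j # bs"
      using parallel_decomp by blast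
    have e: "c @ [i] \<in> out_edges \<I> c" "c @ [j] \<in> out_edges \<I> c"
      using prefix_closed[of "c @ [i]" as] prefix_closed[of "c @ [j]" bs] T d
      by (auto simp: out_edges_def)
    then have "internal \<I> c"
      using prefix_closed[of c "[i]"] by (auto simp: internal_def out_edges_def)
    then have "disjoint_family_on (answers \<I>) (out_edges \<I> c)"
      using I by (simp add: matching_mechanism_def)
    then have "answers \<I> (c @ [i]) \<inter> answers \<I> (c @ [j]) = {}"
      using e d(1) by (auto simp: disjoint_family_on_def)
    moreover have "p (queried \<I> c) \<in> answers \<I> (c @ [i])"
      using a(2)[unfolded passes_def, rule_format, of "length c"] d(2) by simp
    moreover have "p (queried \<I> c) \<in> answers \<I> (c @ [j])"
      using b(2)[unfolded passes_def, rule_format, of "length c"] d(3) by simp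
    ultimately show False by blast
  qed
  with ex show ?thesis by blast
qed


section \<open>Random profiles\<close>

definition random_profile :: "'w set \<Rightarrow> 'm set \<Rightarrow> ('w \<Rightarrow> 'm list) pmf" where
  "random_profile W M = pmf_of_set (profiles W M)"

text \<open>For finite \<open>W\<close> and \<open>M\<close>, the set of profiles is finite and nonempty, as
  \<^const>\<open>pmf_of_set\<close> requires.\<close>

lemma finite_profiles: "finite I \<Longrightarrow> finite X \<Longrightarrow> finite (profiles I X)"
  unfolding profiles_def pref_lists_def
  by (intro finite_PiE) (auto intro: finite_subset[OF _ finite_subset_distinct[of X]])

lemma profiles_nonempty: "profiles I X \<noteq> {}"
proof -
  have "[] \<in> pref_lists X" by (simp add: pref_lists_def)
  then show ?thesis unfolding profiles_def PiE_eq_empty_iff by blast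
qed

end

theory Submission
  imports Defs "HOL-Real_Asymp.Real_Asymp"
begin

text \<open>
  Suppose that women \<open>x\<close>, \<open>y\<close>, \<open>z\<close> rank men \<open>a\<close>, \<open>b\<close>, \<open>c\<close> cyclically: \<open>a > b > c\<close>, \<open>b > c > a\<close> and
  \<open>c > a > b\<close>. Restrict \<open>a\<close> to the lists \<open>yx\<close> and \<open>zy\<close>, \<open>b\<close> to \<open>zy\<close> and \<open>xz\<close>, \<open>c\<close> to \<open>xz\<close> and \<open>yx\<close>, and
  let all other men have the empty list. Consider the first node at which one of the three men, say
  \<open>a\<close>, separates his two lists: answering \<open>yx\<close> truthfully, he may get \<open>x\<close> (when the others report
  \<open>xz\<close> and \<open>yx\<close>), whereas the lie \<open>zy\<close> may give him the preferred \<open>y\<close> (when both others report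
  \<open>xz\<close>), so the mechanism is not OSP for him. The construction is invariant under rotation. If no man
  ever separates his lists, the outcome is constant on the restricted profiles, which is absurd.

  It remains to find such a cyclic pattern in a random \<open>q\<close>. For fixed \<open>a\<close>, \<open>b\<close>, \<open>c\<close>, every woman has
  each of the three orders with probability at least 1/24, independently of the number of men, so
  the pattern is missing with probability at most \<open>3 (23/24)^|W|\<close>; a union bound over the triples of
  men handles polynomially many men. If \<open>W\<close> is small and \<open>M\<close> is large, fix \<open>x\<close>, \<open>y\<close>, \<open>z\<close> and \<open>k\<close>
  disjoint triples of men: all these men are on the three lists with probability at least
  \<open>1 - 9 k / |M|\<close>, and then each triple independently forms the pattern with probability 1/216.
\<close>

section \<open>Cyclic preferences rule out obvious strategy-proofness\<close>

lemma ranked_higher_in_set: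
  assumes "ranked_higher xs u v"
  shows "u \<in> set xs" "v \<in> set xs"
  using assms by (auto simp: ranked_higher_def)

lemma ranked_higher_irrefl: "distinct xs \<Longrightarrow> \<not> ranked_higher xs u u"
  unfolding ranked_higher_def distinct_conv_nth by (metis less_trans less_irrefl)

lemma ranked_higher_trans:
  assumes "distinct xs" "ranked_higher xs u v" "ranked_higher xs v w"
  shows "ranked_higher xs u w"
  using assms unfolding ranked_higher_def distinct_conv_nth by (metis less_trans)

lemma ranked_higher_antisym:
  "distinct xs \<Longrightarrow> ranked_higher xs u v \<Longrightarrow> \<not> ranked_higher xs v u"
  using ranked_higher_trans ranked_higher_irrefl by metis

lemma ranked_higher_pair: "ranked_higher [u, v] u' v' \<longleftrightarrow> u' = u \<and> v' = v"
proof
  assume "ranked_higher [u, v] u' v'"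
  then obtain i j where "i < j" "j < 2" "[u, v] ! i = u'" "[u, v] ! j = v'"
    unfolding ranked_higher_def by auto
  moreover from this have "i = 0" "j = 1" by auto
  ultimately show "u' = u \<and> v' = v" by auto
next
  assume "u' = u \<and> v' = v"
  then show "ranked_higher [u, v] u' v'"
    unfolding ranked_higher_def by (intro exI[of _ 0] exI[of _ 1]) auto
qed

lemma prefers_Some_Some:
  "prefers xs (Some u) (Some v) \<longleftrightarrow> ranked_higher xs u v \<or> (u \<in> set xs \<and> v \<notin> set xs)"
  by (auto simp: prefers_def on_list_def)

lemma prefers_Some_None: "prefers xs (Some u) None \<longleftrightarrow> u \<in> set xs"
  by (auto simp: prefers_def on_list_def)

lemma stable_match_on_list:
  assumes "stable M W p q \<mu>" "m \<in> M" "\<mu> m = Some w"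
  shows "w \<in> set (p m)"
proof -
  have "\<not> (\<mu> m \<noteq> None \<and> \<not> on_list (\<mu> m) (p m))"
    using assms(1,2) unfolding stable_def unstable_def by blast
  then show ?thesis using assms(3) by (auto simp: on_list_def)
qed

lemma stable_no_blocking_pair:
  assumes "stable M W p q \<mu>" "m \<in> M" "w \<in> W" "prefers (p m) (Some w) (\<mu> m)"
  shows "\<not> prefers (q w) (Some m) (match_of_woman \<mu> w)"
  using assms unfolding stable_def unstable_def by blast

lemma matchings_inj:
  "\<mu> \<in> matchings M W \<Longrightarrow> \<mu> m = Some w \<Longrightarrow> \<mu> m' = Some w \<Longrightarrow> m = m'"
  using match_of_woman_eq by (metis option.inject)

text \<open>This case rule keeps the definite description in \<open>match_of_woman\<close> out of
  the stability arguments.\<close>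

lemma match_of_woman_cases:
  assumes "\<mu> \<in> matchings M W"
  obtains "match_of_woman \<mu> w = None" "\<And>m. \<mu> m \<noteq> Some w"
  | m where "m \<in> M" "\<mu> m = Some w" "match_of_woman \<mu> w = Some m"
proof (cases "\<exists>m. \<mu> m = Some w")
  case True
  then obtain m where m: "\<mu> m = Some w" by blast
  then have "m \<in> M" using assms by (auto simp: matchings_def)
  with m match_of_woman_eq[OF assms m] that show ?thesis by blast
next
  case False
  then show ?thesis using that by (auto simp: match_of_woman_def)
qed

section \<open>Cyclic patterns and the matches they force\<close>

definition ranked_chain :: "'a list \<Rightarrow> 'a \<Rightarrow> 'a \<Rightarrow> 'a \<Rightarrow> bool" where
  "ranked_chain xs a b c \<longleftrightarrow> ranked_higher xs a b \<and> ranked_higher xs b c"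

text \<open>This is a Condorcet cycle. Other men may stand anywhere on the three lists, also between
  \<open>a\<close>, \<open>b\<close> and \<open>c\<close>.\<close>

definition cyclic_triple :: "('w \<Rightarrow> 'm list) \<Rightarrow> 'm \<Rightarrow> 'm \<Rightarrow> 'm \<Rightarrow> 'w \<Rightarrow> 'w \<Rightarrow> 'w \<Rightarrow> bool" where
  "cyclic_triple q a b c x y z \<longleftrightarrow>
     ranked_chain (q x) a b c \<and> ranked_chain (q y) b c a \<and> ranked_chain (q z) c a b"

lemma cyclic_triple_rotate:
  "cyclic_triple q a b c x y z \<Longrightarrow> cyclic_triple q b c a y z x"
  by (auto simp: cyclic_triple_def)

text \<open>Any two of the men are strictly ranked by some woman, and any two of the women rank some
  pair of men in opposite ways.\<close>

lemma cyclic_triple_distinct: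
  assumes "cyclic_triple q a b c x y z" "distinct (q x)" "distinct (q y)" "distinct (q z)"
  shows "distinct [a, b, c]" "distinct [x, y, z]"
proof -
  note q = assms(1)[unfolded cyclic_triple_def ranked_chain_def]
  have ac: "ranked_higher (q x) a c" and ba: "ranked_higher (q y) b a" and cb: "ranked_higher (q z) c b"
    using q assms(2-4) ranked_higher_trans by metis+
  show "distinct [a, b, c]"
    using q ac ba cb assms(2-4) ranked_higher_irrefl by (metis distinct_length_2_or_more distinct_singleton)
  show "distinct [x, y, z]"
    using q ac ba cb assms(2-4) ranked_higher_antisym
    by (metis distinct_length_2_or_more distinct_singleton)
qed

definition test_profiles ::
  "'m set \<Rightarrow> 'w set \<Rightarrow> 'm \<Rightarrow> 'm \<Rightarrow> 'm \<Rightarrow> 'w \<Rightarrow> 'w \<Rightarrow> 'w \<Rightarrow> ('m \<Rightarrow> 'w list) set" where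
  "test_profiles M W a b c x y z =
     {p \<in> profiles M W. p a \<in> {[y, x], [z, y]} \<and> p b \<in> {[z, y], [x, z]} \<and> p c \<in> {[x, z], [y, x]} \<and>
        (\<forall>m\<in>M - {a, b, c}. p m = [])}"

text \<open>Thanks to this invariance the arguments below are carried out for \<open>a\<close> alone
  and then transferred to \<open>b\<close> and \<open>c\<close>.\<close>

lemma test_profiles_rotate: "test_profiles M W a b c x y z = test_profiles M W b c a y z x"
  unfolding test_profiles_def by (auto simp: insert_commute)

text \<open>If unmatched, \<open>a\<close> would block with \<open>x\<close>, who ranks him above
  her only other possible partners \<open>b\<close> and \<open>c\<close>. If he had
  \<open>y\<close>, then \<open>c\<close> would lack his first choice \<open>y\<close> and block
  with her, since \<open>y\<close> ranks \<open>c\<close> above \<open>a\<close>.\<close>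

lemma stable_match_top:
  assumes st: "stable M W p q \<mu>" and mu: "\<mu> \<in> matchings M W"
    and M: "a \<in> M" "c \<in> M" and W: "x \<in> W" "y \<in> W"
    and cyc: "cyclic_triple q a b c x y z"
    and dist: "distinct [a, b, c]" "distinct [x, y, z]" "distinct (q x)"
    and p: "p a = [y, x]" "p b = [x, z]" "p c = [y, x]" "\<forall>m\<in>M - {a, b, c}. p m = []"
  shows "\<mu> a = Some x"
proof -
  note q = cyc[unfolded cyclic_triple_def ranked_chain_def]
  have only: "m \<in> {a, b, c}" if "m \<in> M" "\<mu> m = Some w" for m w
  proof (rule ccontr)
    assume "m \<notin> {a, b, c}"
    then have "p m = []" using p(4) that(1) by blast
    then show False using stable_match_on_list[OF st that] by simp
  qed
  have "\<mu> a \<noteq> None"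
  proof
    assume n: "\<mu> a = None"
    then have "\<not> prefers (q x) (Some a) (match_of_woman \<mu> x)"
      using stable_no_blocking_pair[OF st M(1) W(1)] p(1) by (simp add: prefers_Some_None)
    note nbl = this
    from mu show False
    proof (cases rule: match_of_woman_cases[where w = x])
      case 1
      then show False
        using nbl q ranked_higher_in_set[of "q x" a b] by (simp add: prefers_Some_None)
    next
      case (2 m)
      then have "m \<noteq> a" using n by auto
      then have "m = b \<or> m = c" using only[OF 2(1,2)] by simp
      then have "ranked_higher (q x) a m" using q ranked_higher_trans[OF dist(3)] by metis
      then show False using nbl 2 by (simp add: prefers_Some_Some)
    qed
  qed
  moreover have "\<mu> a \<noteq> Some y"
  proof
    assume ay: "\<mu> a = Some y"
    then have "\<mu> c \<noteq> Some y" using matchings_inj[OF mu ay, of c] dist(1) by auto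
    then have "prefers (p c) (Some y) (\<mu> c)"
      using stable_match_on_list[OF st M(2)] p(3)
      by (cases "\<mu> c") (auto simp: prefers_Some_None prefers_Some_Some ranked_higher_pair)
    from stable_no_blocking_pair[OF st M(2) W(2) this] show False
      using match_of_woman_eq[OF mu ay] q by (simp add: prefers_Some_Some)
  qed
  moreover have "w \<in> {x, y}" if "\<mu> a = Some w" for w
    using stable_match_on_list[OF st M(1) that] p(1) by auto
  ultimately show ?thesis by auto
qed

text \<open>Only \<open>a\<close> lists \<open>y\<close>, so if he were unmatched she would be free
  and they would block. If he had \<open>z\<close>, then \<open>b\<close> would have
  \<open>x\<close>, who prefers \<open>b\<close> to \<open>c\<close>; thus \<open>c\<close> would be
  unmatched and block with \<open>z\<close>, who prefers \<open>c\<close> to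
  \<open>a\<close>.\<close>

lemma stable_match_bottom:
  assumes st: "stable M W p q \<mu>" and mu: "\<mu> \<in> matchings M W"
    and M: "a \<in> M" "b \<in> M" "c \<in> M" and W: "x \<in> W" "y \<in> W" "z \<in> W"
    and cyc: "cyclic_triple q a b c x y z"
    and dist: "distinct [a, b, c]" "distinct [x, y, z]"
    and p: "p a = [z, y]" "p b = [x, z]" "p c = [x, z]" "\<forall>m\<in>M - {a, b, c}. p m = []"
  shows "\<mu> a = Some y"
proof -
  note q = cyc[unfolded cyclic_triple_def ranked_chain_def]
  have only: "m \<in> {a, b, c}" if "m \<in> M" "\<mu> m = Some w" for m w
  proof (rule ccontr)
    assume "m \<notin> {a, b, c}"
    then have "p m = []" using p(4) that(1) by blast
    then show False using stable_match_on_list[OF st that] by simp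
  qed
  have "\<mu> a \<noteq> None"
  proof
    assume n: "\<mu> a = None"
    have "\<mu> m \<noteq> Some y" if "m \<in> M" for m
      using only[OF that] stable_match_on_list[OF st that] n p dist by fastforce
    then have "match_of_woman \<mu> y = None"
      using match_of_woman_cases[OF mu, of y] by metis
    moreover have "\<not> prefers (q y) (Some a) (match_of_woman \<mu> y)"
      using stable_no_blocking_pair[OF st M(1) W(2)] p(1) n by (simp add: prefers_Some_None)
    ultimately show False
      using q ranked_higher_in_set[of "q y" c a] by (simp add: prefers_Some_None)
  qed
  moreover have "\<mu> a \<noteq> Some z"
  proof
    assume az: "\<mu> a = Some z"
    have bz: "\<mu> b \<noteq> Some z" and cz: "\<mu> c \<noteq> Some z"
      using matchings_inj[OF mu az, of b] matchings_inj[OF mu az, of c] dist(1) by auto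
    have bx: "\<mu> b = Some x"
    proof (rule ccontr)
      assume nb: "\<mu> b \<noteq> Some x"
      have "prefers (p b) (Some x) (\<mu> b)"
        using nb bz p(2) stable_match_on_list[OF st M(2)]
        by (cases "\<mu> b") (auto simp: prefers_Some_None)
      note nbl = stable_no_blocking_pair[OF st M(2) W(1) this]
      from mu show False
      proof (cases rule: match_of_woman_cases[where w = x])
        case 1
        then show False
          using nbl q ranked_higher_in_set[of "q x" b c] by (simp add: prefers_Some_None)
      next
        case (2 m)
        then have "m = c" using only[OF 2(1,2)] nb az dist(2) by auto
        then show False using nbl 2 q by (simp add: prefers_Some_Some)
      qed
    qed
    have "\<mu> c \<noteq> Some x" using matchings_inj[OF mu bx, of c] dist(1) by auto
    then have "prefers (p c) (Some z) (\<mu> c)"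
      using cz p(3) stable_match_on_list[OF st M(3)]
      by (cases "\<mu> c") (auto simp: prefers_Some_None)
    from stable_no_blocking_pair[OF st M(3) W(3) this] show False
      using match_of_woman_eq[OF mu az] q by (simp add: prefers_Some_Some)
  qed
  moreover have "w \<in> {z, y}" if "\<mu> a = Some w" for w
    using stable_match_on_list[OF st M(1) that] p(1) by auto
  ultimately show ?thesis by auto
qed

section \<open>Following profiles through a mechanism\<close>

lemma implemented_rule_matching:
  assumes "matching_mechanism M W \<I>" "p \<in> profiles M W"
  shows "implemented_rule \<I> p \<in> matchings M W"
proof -
  have "leaf \<I> (THE n. leaf \<I> n \<and> passes \<I> p n)"
    using theI'[OF ex1_leaf[OF assms]] by blast
  then show ?thesis
    using assms(1) by (simp add: implemented_rule_def matching_mechanism_def)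
qed

lemma out_edges_internal:
  assumes "matching_mechanism M W \<I>" "e \<in> out_edges \<I> n"
  shows "internal \<I> n"
proof -
  obtain i where "n @ [i] \<in> nodes \<I>" using assms(2) by (auto simp: out_edges_def)
  moreover have "rooted_tree (nodes \<I>)" using assms(1) by (simp add: matching_mechanism_def)
  ultimately have "n \<in> nodes \<I>" unfolding rooted_tree_def by blast
  then show ?thesis using assms(2) by (auto simp: internal_def)
qed

lemma implemented_rule_eq:
  assumes "matching_mechanism M W \<I>" "p \<in> profiles M W" "leaf \<I> n" "passes \<I> p n"
  shows "implemented_rule \<I> p = leaf_outcome \<I> n"
  using the1_equality[OF ex1_leaf[OF assms(1,2)]] assms(3,4) by (simp add: implemented_rule_def)

lemma passes_available:
  assumes I: "matching_mechanism M W \<I>" and p: "p \<in> profiles M W"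
    and n: "internal \<I> n" "passes \<I> p n"
  shows "p (queried \<I> n) \<in> available W \<I> n"
proof -
  let ?K = "{k. k < length n \<and> queried \<I> (take k n) = queried \<I> n}"
  show ?thesis
  proof (cases "?K = {}")
    case True
    have "queried \<I> n \<in> M" using I n by (simp add: matching_mechanism_def)
    with True p show ?thesis by (auto simp: available_def profiles_def Let_def)
  next
    case False
    have "Max ?K \<in> ?K" using False by (intro Max_in) auto
    then have K: "Max ?K < length n" "queried \<I> (take (Max ?K) n) = queried \<I> n" by blast+
    have "p (queried \<I> (take (Max ?K) n)) \<in> answers \<I> (take (Suc (Max ?K)) n)"
      using n(2) K(1) unfolding passes_def by blast
    then have "p (queried \<I> n) \<in> answers \<I> (take (Suc (Max ?K)) n)" unfolding K(2) .
    then show ?thesis unfolding available_def Let_def if_not_P[OF False] .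
  qed
qed

text \<open>The outgoing edges cover exactly the lists consistent with the earlier answers, so a
  profile that reaches an internal node always finds an edge to continue on.\<close>

lemma passes_extend:
  assumes I: "matching_mechanism M W \<I>" and p: "p \<in> profiles M W"
    and n: "internal \<I> n" "passes \<I> p n"
  obtains e where "e \<in> out_edges \<I> n" "p (queried \<I> n) \<in> answers \<I> e"
proof -
  have "(\<Union>e\<in>out_edges \<I> n. answers \<I> e) = available W \<I> n"
    using I n(1) by (simp add: matching_mechanism_def)
  then show thesis using passes_available[OF assms] that by blast
qed

text \<open>Follow the run of \<open>p\<close> to its leaf: at a node reached by all of
  \<open>D\<close>, the absence of divergence sends all of \<open>D\<close> along the same edge.
  Hence \<open>nodiv\<close> speaks only of nodes reached by all of \<open>D\<close>, where a first
  separation would occur.\<close>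

lemma implemented_rule_constant:
  assumes I: "matching_mechanism M W \<I>" and D: "D \<subseteq> profiles M W"
    and nodiv: "\<And>n p p'. \<lbrakk>internal \<I> n; \<forall>p\<in>D. passes \<I> p n; p \<in> D; p' \<in> D\<rbrakk>
      \<Longrightarrow> \<not> diverge \<I> n (p (queried \<I> n)) (p' (queried \<I> n))"
    and p: "p \<in> D" and p': "p' \<in> D"
  shows "implemented_rule \<I> p = implemented_rule \<I> p'"
proof -
  from ex1_leaf[OF I] p D obtain l where l: "leaf \<I> l" "passes \<I> p l" by blast
  have tree: "rooted_tree (nodes \<I>)" using I by (simp add: matching_mechanism_def)
  \<comment> \<open>The induction runs downwards from the leaf because \<open>rooted_tree\<close>
    leads from a node to its parent.\<close>
  have pre: "take k l \<in> nodes \<I>" if "k \<le> length l" for k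
    using that
  proof (induction k rule: inc_induct)
    case base
    then show ?case using l by (simp add: leaf_def)
  next
    case (step k)
    then show ?case using tree by (auto simp: rooted_tree_def take_Suc_conv_app_nth)
  qed
  have all: "\<forall>r\<in>D. passes \<I> r (take k l)" if "k \<le> length l" for k
    using that
  proof (induction k)
    case 0
    show ?case by (simp add: passes_def)
  next
    case (Suc k)
    let ?n = "take k l" and ?e = "take (Suc k) l"
    have k: "k < length l" using Suc by simp
    have e: "?e \<in> out_edges \<I> ?n"
      using pre[OF Suc.prems] k by (auto simp: out_edges_def take_Suc_conv_app_nth)
    then have int: "internal \<I> ?n" by (rule out_edges_internal[OF I])
    have IH: "\<forall>r\<in>D. passes \<I> r ?n" using Suc by simp
    show ?case
    proof
      fix r assume r: "r \<in> D"
      obtain e' where e': "e' \<in> out_edges \<I> ?n" "r (queried \<I> ?n) \<in> answers \<I> e'"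
        using passes_extend[OF I _ int] r D IH by blast
      have "p (queried \<I> ?n) \<in> answers \<I> ?e" using l(2) k by (simp add: passes_def)
      \<comment> \<open>Here \<open>p\<close> follows \<open>?e\<close> and \<open>r\<close> follows
        \<open>e'\<close>; distinct edges would make their lists diverge.\<close>
      then have "e' = ?e" using nodiv[OF int IH p r] e e' unfolding diverge_def by metis
      have "r (queried \<I> ?n) \<in> answers \<I> ?e" using e'(2) unfolding \<open>e' = ?e\<close> .
      moreover have "r (queried \<I> (take i l)) \<in> answers \<I> (take (Suc i) l)" if "i < k" for i
        using IH r k that by (auto simp: passes_def min_def dest!: bspec spec[of _ i])
      ultimately have "\<forall>i\<le>k. r (queried \<I> (take i l)) \<in> answers \<I> (take (Suc i) l)"
        by (simp add: le_less)
      then show "passes \<I> r ?e"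
        unfolding passes_def using k by (simp add: less_Suc_eq_le min_absorb1)
    qed
  qed
  have "passes \<I> p' l" using all[of "length l"] p' by simp
  then show ?thesis
    using implemented_rule_eq[OF I _ l(1)] l(2) p p' D by (metis subsetD)
qed

lemma ex_test_profile:
  assumes "distinct [a, b, c]" "{a, b, c} \<subseteq> M" "distinct [x, y, z]" "{x, y, z} \<subseteq> W"
    and "la \<in> {[y, x], [z, y]}" "lb \<in> {[z, y], [x, z]}" "lc \<in> {[x, z], [y, x]}"
  obtains p where "p \<in> test_profiles M W a b c x y z" "p a = la" "p b = lb" "p c = lc"
proof
  \<comment> \<open>Outside \<open>M\<close> the value is \<open>undefined\<close> because
    \<open>profiles\<close> is an extensional product.\<close>
  let ?p = "\<lambda>m. if m \<in> M then if m = a then la else if m = b then lb else if m = c then lc else []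
    else undefined"
  have "?p \<in> profiles M W"
    unfolding profiles_def pref_lists_def using assms by (intro PiE_I) auto
  then show "?p \<in> test_profiles M W a b c x y z"
    unfolding test_profiles_def using assms by auto
  show "?p a = la" "?p b = lb" "?p c = lc" using assms by auto
qed

text \<open>The two profiles serve twice: they violate the OSP inequality of \<open>a\<close> at a
  node that separates his lists, and they show that the outcome is not constant on the restricted
  profiles.\<close>

lemma test_profiles_outcomes:
  assumes I: "matching_mechanism M W \<I>" "stable_mechanism M W q \<I>"
    and cyc: "cyclic_triple q a b c x y z" and M: "{a, b, c} \<subseteq> M" and W: "{x, y, z} \<subseteq> W"
    and dq: "distinct (q x)" "distinct (q y)" "distinct (q z)"
  obtains p p' where "p \<in> test_profiles M W a b c x y z" "p' \<in> test_profiles M W a b c x y z"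
    "p a = [y, x]" "p' a = [z, y]" "implemented_rule \<I> p a = Some x"
    "implemented_rule \<I> p' a = Some y"
proof -
  note d = cyclic_triple_distinct[OF cyc dq]
  obtain p where p: "p \<in> test_profiles M W a b c x y z" "p a = [y, x]" "p b = [x, z]" "p c = [y, x]"
    using ex_test_profile[OF d(1) M d(2) W, of "[y, x]" "[x, z]" "[y, x]"] by auto
  obtain p' where p': "p' \<in> test_profiles M W a b c x y z" "p' a = [z, y]" "p' b = [x, z]" "p' c = [x, z]"
    using ex_test_profile[OF d(1) M d(2) W, of "[z, y]" "[x, z]" "[x, z]"] by auto
  have pr: "r \<in> profiles M W" "\<forall>m\<in>M - {a, b, c}. r m = []"
    if "r \<in> test_profiles M W a b c x y z" for r
    using that by (auto simp: test_profiles_def)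
  have st: "stable M W r q (implemented_rule \<I> r)" if "r \<in> profiles M W" for r
    using I(2) that by (auto simp: stable_mechanism_def stable_rule_def)
  have "implemented_rule \<I> p a = Some x"
    using stable_match_top[OF st implemented_rule_matching[OF I(1)] _ _ _ _ cyc d dq(1) p(2-4)]
      pr[OF p(1)] M W by simp
  moreover have "implemented_rule \<I> p' a = Some y"
    using stable_match_bottom[OF st implemented_rule_matching[OF I(1)] _ _ _ _ _ _ cyc d p'(2-4)]
      pr[OF p'(1)] M W by simp
  ultimately show thesis using that p p' by blast
qed

text \<open>At such a node OSP would compare the two profiles of
  \<open>test_profiles_outcomes\<close>: with true list \<open>[y, x]\<close> the man gets
  \<open>x\<close>, whereas the lie yields his first choice \<open>y\<close>.\<close>

lemma OSP_for_no_divergence: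
  assumes I: "matching_mechanism M W \<I>" "stable_mechanism M W q \<I>" "OSP_for M W \<I> a"
    and cyc: "cyclic_triple q a b c x y z" and M: "{a, b, c} \<subseteq> M" and W: "{x, y, z} \<subseteq> W"
    and dq: "distinct (q x)" "distinct (q y)" "distinct (q z)"
    and n: "internal \<I> n" "queried \<I> n = a" "\<forall>p\<in>test_profiles M W a b c x y z. passes \<I> p n"
  shows "\<not> diverge \<I> n [y, x] [z, y]"
proof
  assume div: "diverge \<I> n [y, x] [z, y]"
  obtain p p' where p: "p \<in> test_profiles M W a b c x y z" "p' \<in> test_profiles M W a b c x y z"
    "p a = [y, x]" "p' a = [z, y]" "implemented_rule \<I> p a = Some x"
    "implemented_rule \<I> p' a = Some y"
    using test_profiles_outcomes[OF I(1,2) cyc M W dq] .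
  have "p \<in> profiles M W" "p' \<in> profiles M W" using p by (auto simp: test_profiles_def)
  then have "weakly_prefers (p a) (implemented_rule \<I> p a) (implemented_rule \<I> p' a)"
    using I(3) n p div unfolding OSP_for_def by metis
  then show False
    using p by (simp add: weakly_prefers_def prefers_Some_Some ranked_higher_pair)
qed

lemma diverge_sym: "diverge \<I> n xs ys \<Longrightarrow> diverge \<I> n ys xs"
  unfolding diverge_def by metis

lemma diverge_irrefl:
  assumes "matching_mechanism M W \<I>"
  shows "\<not> diverge \<I> n xs xs"
proof
  assume "diverge \<I> n xs xs"
  then obtain e e' where e: "e \<in> out_edges \<I> n" "e' \<in> out_edges \<I> n" "e \<noteq> e'"
    "xs \<in> answers \<I> e \<inter> answers \<I> e'"
    unfolding diverge_def by blast
  then have "internal \<I> n" using out_edges_internal[OF assms] by blast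
  then have "disjoint_family_on (answers \<I>) (out_edges \<I> n)"
    using assms by (simp add: matching_mechanism_def)
  with e show False by (auto simp: disjoint_family_on_def)
qed

lemma not_diverge_pair:
  assumes "matching_mechanism M W \<I>" "\<not> diverge \<I> n l l'" "xs \<in> {l, l'}" "ys \<in> {l, l'}"
  shows "\<not> diverge \<I> n xs ys"
  using assms diverge_sym diverge_irrefl[OF assms(1)] by blast

theorem cyclic_triple_not_OSP:
  assumes I: "matching_mechanism M W \<I>" "stable_mechanism M W q \<I>"
    and osp: "OSP_for M W \<I> a" "OSP_for M W \<I> b" "OSP_for M W \<I> c"
    and cyc: "cyclic_triple q a b c x y z" and M: "{a, b, c} \<subseteq> M" and W: "{x, y, z} \<subseteq> W"
    and dq: "distinct (q x)" "distinct (q y)" "distinct (q z)"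
  shows False
proof -
  let ?D = "test_profiles M W a b c x y z"
  have D: "?D \<subseteq> profiles M W" by (auto simp: test_profiles_def)
  have cyc': "cyclic_triple q b c a y z x" and cyc'': "cyclic_triple q c a b z x y"
    using cyc cyclic_triple_rotate by metis+
  have D': "?D = test_profiles M W b c a y z x" and D'': "?D = test_profiles M W c a b z x y"
    using test_profiles_rotate by metis+
  have M': "{b, c, a} \<subseteq> M" "{c, a, b} \<subseteq> M" and W': "{y, z, x} \<subseteq> W" "{z, x, y} \<subseteq> W"
    using M W by auto
  have nodiv: "\<not> diverge \<I> n (p (queried \<I> n)) (p' (queried \<I> n))"
    if n: "internal \<I> n" "\<forall>p\<in>?D. passes \<I> p n" and p: "p \<in> ?D" "p' \<in> ?D" for n p p'
  proof -
    have "queried \<I> n \<in> M" using I(1) n(1) by (simp add: matching_mechanism_def)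
    then consider "queried \<I> n = a" | "queried \<I> n = b" | "queried \<I> n = c"
      | "queried \<I> n \<in> M - {a, b, c}" by blast
    then show ?thesis
    proof cases
      case 1
      have "\<not> diverge \<I> n [y, x] [z, y]"
        using OSP_for_no_divergence[OF I osp(1) cyc M W dq n(1) 1] n(2) by simp
      then show ?thesis
        by (rule not_diverge_pair[OF I(1)]) (use p 1 in \<open>auto simp: test_profiles_def\<close>)
    next
      \<comment> \<open>This case and the next one are the first after rotating men and
        women.\<close>
      case 2
      have "\<not> diverge \<I> n [z, y] [x, z]"
        using OSP_for_no_divergence[OF I osp(2) cyc' M'(1) W'(1) dq(2,3,1) n(1) 2] n(2) D' by simp
      then show ?thesis
        by (rule not_diverge_pair[OF I(1)]) (use p 2 in \<open>auto simp: test_profiles_def\<close>)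
    next
      case 3
      have "\<not> diverge \<I> n [x, z] [y, x]"
        using OSP_for_no_divergence[OF I osp(3) cyc'' M'(2) W'(2) dq(3,1,2) n(1) 3] n(2) D'' by simp
      then show ?thesis
        by (rule not_diverge_pair[OF I(1)]) (use p 3 in \<open>auto simp: test_profiles_def\<close>)
    next
      \<comment> \<open>Every other man has the empty list in both profiles, and a list never
        diverges from itself.\<close>
      case 4
      then show ?thesis
        using p diverge_irrefl[OF I(1)] by (simp add: test_profiles_def)
    qed
  qed
  obtain p p' where p: "p \<in> ?D" "p' \<in> ?D" "implemented_rule \<I> p a = Some x"
    "implemented_rule \<I> p' a = Some y"
    using test_profiles_outcomes[OF I(1,2) cyc M W dq] by metis
  have "implemented_rule \<I> p = implemented_rule \<I> p'"
    by (rule implemented_rule_constant[OF I(1) D]) (use nodiv p in blast)+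
  then have "x = y" using p by simp
  then show False using cyclic_triple_distinct[OF cyc dq] by simp
qed

section \<open>Cyclic preferences in a random profile\<close>

lemma pref_lists_remove: "pref_lists (X - {x}) = {xs \<in> pref_lists X. x \<notin> set xs}"
  by (auto simp: pref_lists_def)

lemma pref_lists_unfold: "pref_lists X = insert [] (\<Union>x\<in>X. (#) x ` pref_lists (X - {x}))"
proof (intro equalityI subsetI)
  fix xs assume "xs \<in> pref_lists X"
  then show "xs \<in> insert [] (\<Union>x\<in>X. (#) x ` pref_lists (X - {x}))"
    by (cases xs) (auto simp: pref_lists_def)
qed (auto simp: pref_lists_def)

lemma finite_pref_lists: "finite X \<Longrightarrow> finite (pref_lists X)"
  unfolding pref_lists_def by (rule finite_subset[OF _ finite_subset_distinct[of X]]) auto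

lemma pref_lists_nonempty: "pref_lists X \<noteq> {}"
  using pref_lists_unfold[of X] by blast

text \<open>These are the numbers \<open>\<Sum>k\<le>n. fact n / fact k\<close>, that is 1, 2, 5, 16
  and so on. The summand 1 stands for the empty list, the factor \<open>Suc n\<close> for the choice
  of the first entry.\<close>

primrec num_pref_lists :: "nat \<Rightarrow> nat" where
  "num_pref_lists 0 = 1"
| "num_pref_lists (Suc n) = 1 + Suc n * num_pref_lists n"

lemma card_pref_lists: "finite X \<Longrightarrow> card (pref_lists X) = num_pref_lists (card X)"
proof (induction "card X" arbitrary: X)
  case 0
  then show ?case by (auto simp: pref_lists_def card_1_singleton_iff)
next
  case (Suc n)
  have fin: "finite (\<Union>x\<in>X. (#) x ` pref_lists (X - {x}))"
    using Suc.prems by (intro finite_UN_I finite_imageI finite_pref_lists) auto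
  have "card (\<Union>x\<in>X. (#) x ` pref_lists (X - {x})) = (\<Sum>x\<in>X. card ((#) x ` pref_lists (X - {x})))"
    using Suc.prems finite_pref_lists[of "X - {x}" for x] by (intro card_UN_disjoint) auto
  also have "\<dots> = (\<Sum>x\<in>X. num_pref_lists n)"
  proof (rule sum.cong)
    fix x assume x: "x \<in> X"
    then have "n = card (X - {x})" using Suc by simp
    from Suc.hyps(1)[OF this] Suc.prems this
    show "card ((#) x ` pref_lists (X - {x})) = num_pref_lists n"
      by (simp add: card_image)
  qed simp
  finally have "card (\<Union>x\<in>X. (#) x ` pref_lists (X - {x})) = Suc n * num_pref_lists n"
    using Suc.hyps(2) by simp
  moreover have "[] \<notin> (\<Union>x\<in>X. (#) x ` pref_lists (X - {x}))" by blast
  ultimately show ?case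
    using fin Suc.hyps(2)[symmetric] by (subst pref_lists_unfold) simp
qed

text \<open>The lists avoiding \<open>x\<close> are those over one element fewer, so the recursion
  of \<open>num_pref_lists\<close> gives the bound. In probabilistic terms, a fixed element is
  missing with probability at most \<open>1 / card X\<close>.\<close>

lemma card_pref_lists_missing:
  assumes "finite X" "x \<in> X"
  shows "card X * card {xs \<in> pref_lists X. x \<notin> set xs} \<le> card (pref_lists X)"
proof -
  obtain n where n: "card X = Suc n" using assms by (cases "card X") auto
  then have "card (X - {x}) = n" using assms by simp
  then show ?thesis
    using assms n by (simp add: card_pref_lists flip: pref_lists_remove)
qed

section \<open>The order of three given men on a list\<close>

lemma ranked_higher_map:
  assumes "ranked_higher xs u v"
  shows "ranked_higher (map \<pi> xs) (\<pi> u) (\<pi> v)"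
  using assms unfolding ranked_higher_def by (metis length_map nth_map less_trans)

lemma ranked_higher_total:
  assumes "u \<in> set xs" "v \<in> set xs" "u \<noteq> v"
  shows "ranked_higher xs u v \<or> ranked_higher xs v u"
  using assms unfolding ranked_higher_def in_set_conv_nth by (metis linorder_neqE_nat)

lemma ranked_chain_map:
  "ranked_chain xs a b c \<Longrightarrow> ranked_chain (map \<pi> xs) (\<pi> a) (\<pi> b) (\<pi> c)"
  by (auto simp: ranked_chain_def ranked_higher_map)

text \<open>A list that contains all three ranks them in some order; relabelling the three turns
  that order into the desired one.\<close>

lemma ex_permutation_ranked_chain:
  assumes abc: "distinct [a, b, c]" "{a, b, c} \<subseteq> set xs"
  obtains \<pi> where "\<pi> permutes {a, b, c}" "ranked_chain (map \<pi> xs) a b c"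
proof -
  have "\<exists>a' b' c'. {a', b', c'} = {a, b, c} \<and> ranked_chain xs a' b' c'"
  proof -
    have "ranked_higher xs a b \<or> ranked_higher xs b a" "ranked_higher xs b c \<or> ranked_higher xs c b"
      "ranked_higher xs a c \<or> ranked_higher xs c a"
      using abc by (simp_all add: ranked_higher_total)
    moreover have "{a, c, b} = {a, b, c}" "{b, a, c} = {a, b, c}" "{b, c, a} = {a, b, c}"
      "{c, a, b} = {a, b, c}" "{c, b, a} = {a, b, c}" by auto
    ultimately show ?thesis unfolding ranked_chain_def by metis
  qed
  then obtain a' b' c' where eq: "{a', b', c'} = {a, b, c}" and ch: "ranked_chain xs a' b' c'"
    by blast
  have "card {a, b, c} = 3" using abc by simp
  then have d: "distinct [a', b', c']" using card_distinct[of "[a', b', c']"] eq by simp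
  define \<pi> where "\<pi> = id(a' := a, b' := b, c' := c)"
  have \<pi>: "\<pi> a' = a" "\<pi> b' = b" "\<pi> c' = c" using d by (auto simp: \<pi>_def)
  have "bij_betw \<pi> {a', b', c'} {a, b, c}"
    unfolding bij_betw_def inj_on_def using \<pi> abc by auto
  then have "\<pi> permutes {a, b, c}"
    unfolding eq by (rule bij_imp_permutes) (use eq in \<open>auto simp: \<pi>_def\<close>)
  moreover have "ranked_chain (map \<pi> xs) a b c"
    using ranked_chain_map[OF ch, of \<pi>] \<pi> by simp
  ultimately show thesis by (rule that)
qed

lemma card_permutes_three: "distinct [a, b, c] \<Longrightarrow> card {\<pi>. \<pi> permutes {a, b, c}} = 6"
  by (subst card_permutations[OF refl]) (auto simp: fact_numeral)

lemma map_permutes_pref_lists: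
  assumes "\<pi> permutes S" "S \<subseteq> X" "xs \<in> pref_lists X"
  shows "map \<pi> xs \<in> pref_lists X"
proof -
  have "\<pi> permutes X" using assms(1,2) by (rule permutes_subset)
  then have "\<pi> ` set xs \<subseteq> X" using assms(3) permutes_image by (fastforce simp: pref_lists_def)
  moreover have "inj_on \<pi> (set xs)" using permutes_inj_on[OF assms(1)] .
  ultimately show ?thesis using assms(3) by (auto simp: pref_lists_def distinct_map)
qed

lemma map_permutes_inv: "\<pi> permutes S \<Longrightarrow> map (inv \<pi>) (map \<pi> xs) = xs"
  by (simp add: permutes_inv_o(2))

text \<open>Applying the six relabellings to the lists with the desired order reaches every list
  that contains the three men.\<close>

lemma card_le_ranked_chain:
  assumes X: "finite X" "distinct [a, b, c]" "{a, b, c} \<subseteq> X"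
  shows "card {xs \<in> pref_lists X. {a, b, c} \<subseteq> set xs}
    \<le> 6 * card {xs \<in> pref_lists X. ranked_chain xs a b c}" (is "card ?A \<le> 6 * card ?G")
proof -
  let ?P = "{\<pi>. \<pi> permutes {a, b, c}}"
  have fin: "finite ?P" "finite ?G"
    using finite_permutations[of "{a, b, c}"] finite_pref_lists[OF X(1)] by simp_all
  have "?A \<subseteq> (\<Union>\<pi>\<in>?P. map \<pi> ` ?G)"
  proof
    fix xs assume xs: "xs \<in> ?A"
    then obtain \<pi> where \<pi>: "\<pi> permutes {a, b, c}" "ranked_chain (map \<pi> xs) a b c"
      using ex_permutation_ranked_chain[OF X(2)] by blast
    then have "map \<pi> xs \<in> ?G" using xs map_permutes_pref_lists[OF _ X(3)] by simp
    then have "map (inv \<pi>) (map \<pi> xs) \<in> map (inv \<pi>) ` ?G" by (rule imageI)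
    then have "xs \<in> map (inv \<pi>) ` ?G" unfolding map_permutes_inv[OF \<pi>(1)] .
    then show "xs \<in> (\<Union>\<pi>\<in>?P. map \<pi> ` ?G)" using permutes_inv[OF \<pi>(1)] by blast
  qed
  then have "card ?A \<le> card (\<Union>\<pi>\<in>?P. map \<pi> ` ?G)" using fin by (intro card_mono) auto
  also have "\<dots> \<le> (\<Sum>\<pi>\<in>?P. card (map \<pi> ` ?G))" using fin by (intro card_UN_le)
  also have "\<dots> \<le> (\<Sum>\<pi>\<in>?P. card ?G)" using fin by (intro sum_mono card_image_le)
  also have "\<dots> = 6 * card ?G" using card_permutes_three[OF X(2)] by simp
  finally show ?thesis .
qed

text \<open>With at least four men, each of the three is missing from at most a quarter of the
  lists; so at least a quarter contain all three, and a sixth of these have the desired order. With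
  exactly three men this union bound is vacuous, but then there are 16 lists and
  \<open>[a, b, c]\<close> is one of them.\<close>

lemma card_pref_lists_le_ranked_chain:
  assumes X: "finite X" "distinct [a, b, c]" "{a, b, c} \<subseteq> X"
  shows "card (pref_lists X) \<le> 24 * card {xs \<in> pref_lists X. ranked_chain xs a b c}"
    (is "_ \<le> 24 * card ?G")
proof -
  let ?L = "pref_lists X" and ?miss = "\<lambda>t. {xs \<in> pref_lists X. t \<notin> set xs}"
  have fin: "finite ?L" using X(1) by (rule finite_pref_lists)
  have "card {a, b, c} \<le> card X" using X by (intro card_mono) auto
  then have "3 \<le> card X" using X(2) by simp
  then consider "card X = 3" | "4 \<le> card X" by linarith
  then show ?thesis
  proof cases
    case 1
    have "[a, b, c] \<in> ?G"
    proof -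
      have "ranked_higher [a, b, c] a b" "ranked_higher [a, b, c] b c"
        unfolding ranked_higher_def by (rule exI[of _ 0], rule exI[of _ 1], simp)
          (rule exI[of _ 1], rule exI[of _ 2], simp)
      then show ?thesis using X by (simp add: pref_lists_def ranked_chain_def)
    qed
    then have "card ?G > 0" using fin by (auto simp: card_gt_0_iff)
    moreover have "card ?L = 16" using card_pref_lists[OF X(1)] 1 by (simp add: numeral_eq_Suc)
    ultimately show ?thesis by simp
  next
    case 2
    have miss: "4 * card (?miss t) \<le> card ?L" if "t \<in> X" for t
      using card_pref_lists_missing[OF X(1) that] mult_le_mono1[OF 2, of "card (?miss t)"] by linarith
    have "?L \<subseteq> {xs \<in> ?L. {a, b, c} \<subseteq> set xs} \<union> (?miss a \<union> ?miss b \<union> ?miss c)" by auto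
    then have "card ?L \<le> card ({xs \<in> ?L. {a, b, c} \<subseteq> set xs} \<union> (?miss a \<union> ?miss b \<union> ?miss c))"
      using fin by (intro card_mono) auto
    also have "\<dots> \<le> card {xs \<in> ?L. {a, b, c} \<subseteq> set xs} + (card (?miss a) + card (?miss b) + card (?miss c))"
      by (meson add_mono card_Un_le order.trans order_refl)
    finally show ?thesis
      using miss[of a] miss[of b] miss[of c] X(3) card_le_ranked_chain[OF X] by auto
  qed
qed

section \<open>Many women: patterns for three fixed men\<close>

lemma prob_random_profile:
  assumes "finite W" "finite M"
  shows "measure_pmf.prob (random_profile W M) A
    = card (profiles W M \<inter> A) / card (profiles W M)"
  unfolding random_profile_def
  using assms by (simp add: measure_pmf_of_set finite_profiles profiles_nonempty)

lemma prob_random_profile_mono: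
  assumes "finite W" "finite M" "\<And>q. q \<in> profiles W M \<Longrightarrow> q \<in> A \<Longrightarrow> q \<in> B"
  shows "measure_pmf.prob (random_profile W M) A \<le> measure_pmf.prob (random_profile W M) B"
proof -
  have "card (profiles W M \<inter> A) \<le> card (profiles W M \<inter> B)"
    using assms finite_profiles by (intro card_mono) blast+
  then show ?thesis using assms by (simp add: prob_random_profile divide_right_mono)
qed

text \<open>A uniform profile consists of independent uniform lists, so conditions on the separate
  lists have the product as their probability.\<close>

lemma prob_random_profile_PiE:
  assumes "finite W" "finite M" "\<And>w. w \<in> W \<Longrightarrow> L w \<subseteq> pref_lists M"
  shows "measure_pmf.prob (random_profile W M) {q. \<forall>w\<in>W. q w \<in> L w}
    = (\<Prod>w\<in>W. card (L w) / card (pref_lists M))"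
proof -
  have "profiles W M \<inter> {q. \<forall>w\<in>W. q w \<in> L w} = (\<Pi>\<^sub>E w\<in>W. L w)"
    using assms(3) unfolding profiles_def by fastforce
  then show ?thesis
    using assms(1,2) by (simp add: prob_random_profile profiles_def card_PiE prod_dividef of_nat_prod)
qed

text \<open>Each woman independently fails to have the order with probability at most
  \<open>1 - 1 / 24\<close>.\<close>

lemma prob_no_ranked_chain:
  assumes "finite W" "finite M" "distinct [a, b, c]" "{a, b, c} \<subseteq> M"
  shows "measure_pmf.prob (random_profile W M) {q. \<forall>w\<in>W. \<not> ranked_chain (q w) a b c}
    \<le> (23 / 24) ^ card W"
proof -
  let ?L = "pref_lists M" and ?G = "{xs \<in> pref_lists M. ranked_chain xs a b c}"
  have fin: "finite ?L" using assms by (simp add: finite_pref_lists)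
  have pos: "card ?L > 0" using fin pref_lists_nonempty by (simp add: card_gt_0_iff)
  have "card (?L - ?G) = card ?L - card ?G" "card ?G \<le> card ?L"
    using fin by (auto intro!: card_Diff_subset card_mono)
  then have "24 * card (?L - ?G) \<le> 23 * card ?L"
    using card_pref_lists_le_ranked_chain[OF assms(2-4)] by linarith
  then have "card (?L - ?G) / card ?L \<le> 23 / 24"
    using pos by (simp add: field_simps)
  then have le: "(card (?L - ?G) / card ?L) ^ card W \<le> (23 / 24) ^ card W"
    by (intro power_mono) auto
  have "measure_pmf.prob (random_profile W M) {q. \<forall>w\<in>W. \<not> ranked_chain (q w) a b c}
      \<le> measure_pmf.prob (random_profile W M) {q. \<forall>w\<in>W. q w \<in> ?L - ?G}"
    using assms(1,2) by (intro prob_random_profile_mono) (auto simp: profiles_def)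
  also have "\<dots> = (card (?L - ?G) / card ?L) ^ card W"
    using prob_random_profile_PiE[OF assms(1,2), of "\<lambda>_. ?L - ?G"] by simp
  finally show ?thesis using le by simp
qed

text \<open>If the pattern is absent, then one of its three orders occurs with no woman at all. The
  bound is the same for all three orders, hence the factor 3.\<close>

lemma prob_no_cyclic_triple:
  assumes "finite W" "finite M" "distinct [a, b, c]" "{a, b, c} \<subseteq> M"
  shows "measure_pmf.prob (random_profile W M)
      {q. \<not> (\<exists>x\<in>W. \<exists>y\<in>W. \<exists>z\<in>W. cyclic_triple q a b c x y z)} \<le> 3 * (23 / 24) ^ card W"
proof -
  let ?pr = "measure_pmf.prob (random_profile W M)"
  let ?E = "\<lambda>a b c. {q. \<forall>w\<in>W. \<not> ranked_chain (q w) a b c}"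
  have "?pr {q. \<not> (\<exists>x\<in>W. \<exists>y\<in>W. \<exists>z\<in>W. cyclic_triple q a b c x y z)}
      \<le> ?pr (?E a b c \<union> ?E b c a \<union> ?E c a b)"
    by (intro measure_pmf.finite_measure_mono) (auto simp: cyclic_triple_def)
  also have "\<dots> \<le> ?pr (?E a b c) + ?pr (?E b c a) + ?pr (?E c a b)"
    using measure_Un_le[of "?E a b c \<union> ?E b c a" "random_profile W M" "?E c a b"]
      measure_Un_le[of "?E a b c" "random_profile W M" "?E b c a"] by simp
  also have "\<dots> \<le> 3 * (23 / 24) ^ card W"
    using assms prob_no_ranked_chain[OF assms(1,2), of a b c]
      prob_no_ranked_chain[OF assms(1,2), of b c a] prob_no_ranked_chain[OF assms(1,2), of c a b]
    by auto
  finally show ?thesis .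
qed

section \<open>Many men: patterns for three fixed women\<close>

lemma prob_missing:
  assumes "finite W" "finite M" "w \<in> W" "m \<in> M"
  shows "measure_pmf.prob (random_profile W M) {q. m \<notin> set (q w)} \<le> 1 / card M"
proof -
  let ?L = "pref_lists M" and ?G = "{xs \<in> pref_lists M. m \<notin> set xs}"
  have fin: "finite ?L" using assms by (simp add: finite_pref_lists)
  have pos: "card ?L > 0" using fin pref_lists_nonempty by (simp add: card_gt_0_iff)
  have posM: "card M > 0" using assms by (auto simp: card_gt_0_iff)
  have "measure_pmf.prob (random_profile W M) {q. m \<notin> set (q w)}
      \<le> measure_pmf.prob (random_profile W M) {q. \<forall>v\<in>W. q v \<in> (if v = w then ?G else ?L)}"
    using assms(1,2) by (intro prob_random_profile_mono) (auto simp: profiles_def)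
  also have "\<dots> = (\<Prod>v\<in>W. card (if v = w then ?G else ?L) / card ?L)"
    using assms(1,2) by (intro prob_random_profile_PiE) auto
  also have "\<dots> = (\<Prod>v\<in>W. if v = w then card ?G / card ?L else 1)"
    using pos by (intro prod.cong) auto
  also have "\<dots> = card ?G / card ?L"
    using assms(1,3) by simp
  also have "\<dots> \<le> 1 / card M"
    using card_pref_lists_missing[OF assms(2,4)] pos posM
    by (simp add: field_simps flip: of_nat_mult)
  finally show ?thesis .
qed

text \<open>Permuting \<open>a\<close>, \<open>b\<close>, \<open>c\<close> independently in the three lists reaches a cyclic configuration, so an
  invariant set of profiles is covered by \<open>6^3\<close> bijective images of its cyclic part.\<close>

lemma card_le_cyclic_triple:
  fixes x y z :: 'w
  defines "act \<equiv> \<lambda>\<pi> \<rho> \<tau> (q :: 'w \<Rightarrow> 'm list). q(x := map \<pi> (q x), y := map \<rho> (q y), z := map \<tau> (q z))"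
  assumes B: "finite B" "\<And>q. q \<in> B \<Longrightarrow> {a, b, c} \<subseteq> set (q x) \<inter> set (q y) \<inter> set (q z)"
    and abc: "distinct [a, b, c]" and xyz: "distinct [x, y, z]"
    and inv: "\<And>\<pi> \<rho> \<tau> q. \<lbrakk>q \<in> B; \<pi> permutes {a, b, c}; \<rho> permutes {a, b, c}; \<tau> permutes {a, b, c}\<rbrakk>
      \<Longrightarrow> act \<pi> \<rho> \<tau> q \<in> B"
  shows "card B \<le> 216 * card {q \<in> B. cyclic_triple q a b c x y z}" (is "_ \<le> 216 * card ?G")
proof -
  let ?P = "{\<pi>. \<pi> permutes {a, b, c}}"
  let ?act = "\<lambda>(\<pi>, \<rho>, \<tau>). act \<pi> \<rho> \<tau>"
  have fin: "finite (?P \<times> ?P \<times> ?P)" "finite ?G" using B(1) by (auto simp: finite_permutations)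
  have card: "card (?P \<times> ?P \<times> ?P) = 216"
    using card_permutes_three[OF abc] by (simp add: card_cartesian_product)
  have "B \<subseteq> (\<Union>t\<in>?P \<times> ?P \<times> ?P. ?act t ` ?G)"
  proof
    fix q assume q: "q \<in> B"
    obtain \<pi> where \<pi>: "\<pi> permutes {a, b, c}" "ranked_chain (map \<pi> (q x)) a b c"
      using ex_permutation_ranked_chain[OF abc] B(2)[OF q] by (metis le_inf_iff)
    have s: "{b, c, a} = {a, b, c}" "{c, a, b} = {a, b, c}" by auto
    have d: "distinct [b, c, a]" "distinct [c, a, b]" using abc by auto
    obtain \<rho> where \<rho>: "\<rho> permutes {a, b, c}" "ranked_chain (map \<rho> (q y)) b c a"
      using ex_permutation_ranked_chain[OF d(1)] B(2)[OF q] s by (metis le_inf_iff)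
    obtain \<tau> where \<tau>: "\<tau> permutes {a, b, c}" "ranked_chain (map \<tau> (q z)) c a b"
      using ex_permutation_ranked_chain[OF d(2)] B(2)[OF q] s by (metis le_inf_iff)
    have "act \<pi> \<rho> \<tau> q \<in> ?G"
      using inv[OF q \<pi>(1) \<rho>(1) \<tau>(1)] \<pi> \<rho> \<tau> xyz by (simp add: cyclic_triple_def act_def)
    moreover have "q = act (inv \<pi>) (inv \<rho>) (inv \<tau>) (act \<pi> \<rho> \<tau> q)"
      using xyz map_permutes_inv[OF \<pi>(1)] map_permutes_inv[OF \<rho>(1)] map_permutes_inv[OF \<tau>(1)]
      by (auto simp: act_def fun_eq_iff simp del: map_map)
    ultimately have "q \<in> ?act (inv \<pi>, inv \<rho>, inv \<tau>) ` ?G" by (auto intro: image_eqI)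
    then show "q \<in> (\<Union>t\<in>?P \<times> ?P \<times> ?P. ?act t ` ?G)"
      using permutes_inv[OF \<pi>(1)] permutes_inv[OF \<rho>(1)] permutes_inv[OF \<tau>(1)] by blast
  qed
  then have "card B \<le> card (\<Union>t\<in>?P \<times> ?P \<times> ?P. ?act t ` ?G)"
    using fin by (intro card_mono finite_UN_I) auto
  also have "\<dots> \<le> (\<Sum>t\<in>?P \<times> ?P \<times> ?P. card (?act t ` ?G))" using fin(1) by (rule card_UN_le)
  also have "\<dots> \<le> (\<Sum>t\<in>?P \<times> ?P \<times> ?P. card ?G)" using fin(2) by (intro sum_mono card_image_le)
  also have "\<dots> = 216 * card ?G" using card by simp
  finally show ?thesis .
qed

text \<open>Both \<open>\<pi>\<close> and its inverse fix everything outside \<open>S\<close>, so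
  \<open>ranked_higher_map\<close> applies in both directions. Consequently, relabelling one triple
  of men leaves the orders within disjoint triples intact.\<close>

lemma ranked_higher_map_permutes:
  assumes "\<pi> permutes S" "u \<notin> S" "v \<notin> S"
  shows "ranked_higher (map \<pi> xs) u v \<longleftrightarrow> ranked_higher xs u v"
proof -
  have "\<pi> u = u" "\<pi> v = v" "inv \<pi> u = u" "inv \<pi> v = v"
    using assms permutes_inv[OF assms(1)] by (auto simp: permutes_not_in)
  then show ?thesis
    using ranked_higher_map[of xs u v \<pi>] ranked_higher_map[of "map \<pi> xs" u v "inv \<pi>"]
      map_permutes_inv[OF assms(1)] by auto
qed

lemma ranked_chain_map_permutes:
  assumes "\<pi> permutes S" "u \<notin> S" "v \<notin> S" "w \<notin> S"
  shows "ranked_chain (map \<pi> xs) u v w \<longleftrightarrow> ranked_chain xs u v w"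
  using ranked_higher_map_permutes[OF assms(1)] assms(2-) by (simp add: ranked_chain_def)

lemma set_map_permutes:
  assumes "\<pi> permutes S" "S \<subseteq> set xs"
  shows "set (map \<pi> xs) = set xs"
  using permutes_image[OF permutes_subset[OF assms]] by simp

text \<open>The triples are treated one at a time. Permuting the triple with index \<open>j\<close>
  in the lists of \<open>x\<close>, \<open>y\<close>, \<open>z\<close> preserves \<open>B j\<close>,
  as it changes neither who is listed nor the order within earlier triples. So at least 1/216 of
  \<open>B j\<close> has the pattern at this triple, and \<open>B (Suc j)\<close> loses that part.
  This count replaces an argument by conditional independence.\<close>

lemma card_no_cyclic_triple_men:
  fixes f :: "nat \<Rightarrow> 'm" and k :: nat and x y z :: 'w
  assumes fin: "finite W" "finite M" and W: "distinct [x, y, z]" "{x, y, z} \<subseteq> W"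
    and f: "inj_on f {..<3 * k}" "f ` {..<3 * k} \<subseteq> M"
  defines "B \<equiv> \<lambda>j. {q \<in> profiles W M. f ` {..<3 * k} \<subseteq> set (q x) \<inter> set (q y) \<inter> set (q z) \<and>
      (\<forall>i<j. \<not> cyclic_triple q (f (3 * i)) (f (3 * i + 1)) (f (3 * i + 2)) x y z)}"
  shows "j \<le> k \<Longrightarrow> real (card (B j)) \<le> (215 / 216) ^ j * card (profiles W M)"
proof (induction j)
  case 0
  have "card (B 0) \<le> card (profiles W M)"
    unfolding B_def using fin by (intro card_mono finite_profiles) auto
  then show ?case by simp
next
  case (Suc j)
  let ?a = "f (3 * j)" and ?b = "f (3 * j + 1)" and ?c = "f (3 * j + 2)"
  have abc: "distinct [?a, ?b, ?c]" "{?a, ?b, ?c} \<subseteq> f ` {..<3 * k}"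
    using Suc.prems by (auto simp: inj_on_eq_iff[OF f(1)])
  have other: "f (3 * i) \<notin> {?a, ?b, ?c}" "f (3 * i + 1) \<notin> {?a, ?b, ?c}" "f (3 * i + 2) \<notin> {?a, ?b, ?c}"
    if "i < j" for i
    using that Suc.prems by (auto simp: inj_on_eq_iff[OF f(1)])
  have finB: "finite (B j)" unfolding B_def using finite_profiles[OF fin] by simp
  let ?G = "{q \<in> B j. cyclic_triple q ?a ?b ?c x y z}"
  have "card (B j) \<le> 216 * card ?G"
  proof (rule card_le_cyclic_triple[OF finB _ abc(1) W(1)])
    show "{?a, ?b, ?c} \<subseteq> set (q x) \<inter> set (q y) \<inter> set (q z)" if "q \<in> B j" for q
      using that abc(2) unfolding B_def by blast
  next
    fix \<pi> \<rho> \<tau> q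
    assume q: "q \<in> B j" and p: "\<pi> permutes {?a, ?b, ?c}" "\<rho> permutes {?a, ?b, ?c}" "\<tau> permutes {?a, ?b, ?c}"
    let ?q = "q(x := map \<pi> (q x), y := map \<rho> (q y), z := map \<tau> (q z))"
    have qv: "?q x = map \<pi> (q x)" "?q y = map \<rho> (q y)" "?q z = map \<tau> (q z)" using W(1) by auto
    have qP: "q \<in> profiles W M"
      and S: "f ` {..<3 * k} \<subseteq> set (q x)" "f ` {..<3 * k} \<subseteq> set (q y)" "f ` {..<3 * k} \<subseteq> set (q z)"
      and nc: "\<And>i. i < j \<Longrightarrow> \<not> cyclic_triple q (f (3 * i)) (f (3 * i + 1)) (f (3 * i + 2)) x y z"
      using q unfolding B_def by auto
    have M: "{?a, ?b, ?c} \<subseteq> M" using abc(2) f(2) by blast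
    have "?q \<in> profiles W M"
      using qP W(2) map_permutes_pref_lists[OF p(1) M] map_permutes_pref_lists[OF p(2) M]
        map_permutes_pref_lists[OF p(3) M]
      unfolding profiles_def by (auto simp: PiE_iff extensional_def)
    moreover have "f ` {..<3 * k} \<subseteq> set (?q x) \<inter> set (?q y) \<inter> set (?q z)"
      unfolding qv set_map_permutes[OF p(1) order.trans[OF abc(2) S(1)]]
        set_map_permutes[OF p(2) order.trans[OF abc(2) S(2)]]
        set_map_permutes[OF p(3) order.trans[OF abc(2) S(3)]]
      using S by simp
    moreover have "\<not> cyclic_triple ?q (f (3 * i)) (f (3 * i + 1)) (f (3 * i + 2)) x y z" if "i < j" for i
      using nc[OF that] ranked_chain_map_permutes[OF p(1)] ranked_chain_map_permutes[OF p(2)]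
        ranked_chain_map_permutes[OF p(3)] other[OF that]
      unfolding cyclic_triple_def qv by simp
    ultimately show "?q \<in> B j" unfolding B_def by blast
  qed
  moreover have "B (Suc j) = B j - ?G" unfolding B_def by (auto simp: less_Suc_eq)
  then have "card (B (Suc j)) = card (B j) - card ?G" using finB by (simp add: card_Diff_subset)
  moreover have "card ?G \<le> card (B j)" using finB by (intro card_mono) auto
  ultimately have "216 * card (B (Suc j)) \<le> 215 * card (B j)" by linarith
  then have "real (card (B (Suc j))) \<le> 215 / 216 * real (card (B j))" by linarith
  also have "\<dots> \<le> 215 / 216 * ((215 / 216) ^ j * card (profiles W M))"
    using Suc by (intro mult_left_mono) auto
  finally show ?case by simp
qed

text \<open>Event \<open>A\<close> says that one of \<open>3 * k\<close> chosen men is missing from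
  one of three lists, which are \<open>9 * k\<close> possibilities of probability at most
  \<open>1 / card M\<close> each. Event \<open>B\<close> says that all of them are listed but none
  of the \<open>k\<close> triples forms the pattern.\<close>

lemma prob_no_cyclic_triple_men:
  fixes M :: "'m set" and W :: "'w set"
  assumes fin: "finite W" "finite M" and W: "distinct [x, y, z]" "{x, y, z} \<subseteq> W" and k: "3 * k \<le> card M"
  shows "measure_pmf.prob (random_profile W M)
      {q. \<not> (\<exists>a\<in>M. \<exists>b\<in>M. \<exists>c\<in>M. cyclic_triple q a b c x y z)}
    \<le> 9 * real k / real (card M) + (215 / 216) ^ k"
proof -
  let ?pr = "measure_pmf.prob (random_profile W M)"
  obtain g where g: "bij_betw g {0..<card M} M" using ex_bij_betw_nat_finite[OF fin(2)] by blast
  have f: "inj_on g {..<3 * k}" "g ` {..<3 * k} \<subseteq> M"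
    using g k unfolding bij_betw_def by (auto intro: inj_on_subset)
  define B where "B = {q \<in> profiles W M. g ` {..<3 * k} \<subseteq> set (q x) \<inter> set (q y) \<inter> set (q z) \<and>
      (\<forall>i<k. \<not> cyclic_triple q (g (3 * i)) (g (3 * i + 1)) (g (3 * i + 2)) x y z)}"
  define A where "A = (\<Union>(i, w)\<in>{..<3 * k} \<times> {x, y, z}. {q :: 'w \<Rightarrow> 'm list. g i \<notin> set (q w)})"
  have "?pr {q. \<not> (\<exists>a\<in>M. \<exists>b\<in>M. \<exists>c\<in>M. cyclic_triple q a b c x y z)} \<le> ?pr (A \<union> B)"
  proof (rule prob_random_profile_mono[OF fin])
    fix q assume q: "q \<in> profiles W M" "q \<in> {q. \<not> (\<exists>a\<in>M. \<exists>b\<in>M. \<exists>c\<in>M. cyclic_triple q a b c x y z)}"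
    have "g (3 * i) \<in> M" "g (3 * i + 1) \<in> M" "g (3 * i + 2) \<in> M" if "i < k" for i
      using f(2) that by auto
    then show "q \<in> A \<union> B" using q unfolding A_def B_def by blast
  qed
  also have "\<dots> \<le> ?pr A + ?pr B" by (rule measure_Un_le) auto
  also have "?pr A \<le> (\<Sum>(i, w)\<in>{..<3 * k} \<times> {x, y, z}. ?pr {q. g i \<notin> set (q w)})"
    unfolding A_def using measure_pmf.finite_measure_subadditive_finite[of "{..<3 * k} \<times> {x, y, z}"
        "\<lambda>(i, w). {q. g i \<notin> set (q w)}" "random_profile W M"]
    by (simp add: case_prod_unfold)
  also have "\<dots> \<le> (\<Sum>(i, w)\<in>{..<3 * k} \<times> {x, y, z}. 1 / card M)"
    using f(2) W(2) by (intro sum_mono) (auto intro!: prob_missing[OF fin])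
  also have "\<dots> = 9 * real k / real (card M)"
    using W(1) by (simp add: card_cartesian_product case_prod_unfold)
  also have "?pr B \<le> (215 / 216) ^ k"
  proof -
    have "real (card B) \<le> (215 / 216) ^ k * card (profiles W M)"
      unfolding B_def using card_no_cyclic_triple_men[OF fin W f order_refl] .
    moreover have "profiles W M \<inter> B = B" unfolding B_def by blast
    moreover have "card (profiles W M) > 0"
      using finite_profiles[OF fin] profiles_nonempty by (simp add: card_gt_0_iff)
    ultimately show ?thesis using prob_random_profile[OF fin, of B] by (simp add: divide_le_eq)
  qed
  finally show ?thesis by simp
qed

section \<open>From patterns to the probability of OSP\<close>

lemma profiles_distinct: "q \<in> profiles W M \<Longrightarrow> w \<in> W \<Longrightarrow> distinct (q w)"
  by (auto simp: profiles_def pref_lists_def)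

lemma prob_OSP_three_men:
  fixes M :: "'m set" and W :: "'w set"
  assumes fin: "finite W" "finite M" and abc: "distinct [a, b, c]" "{a, b, c} \<subseteq> M"
  shows "measure_pmf.prob (random_profile W M)
      {q. \<exists>\<I>. matching_mechanism M W \<I> \<and> stable_mechanism M W q \<I> \<and>
             OSP_for M W \<I> a \<and> OSP_for M W \<I> b \<and> OSP_for M W \<I> c}
    \<le> 3 * (23 / 24) ^ card W"
proof (rule order.trans[OF prob_random_profile_mono[OF fin] prob_no_cyclic_triple[OF fin abc]])
  fix q :: "'w \<Rightarrow> 'm list"
  assume q: "q \<in> profiles W M" and "q \<in> {q. \<exists>\<I>. matching_mechanism M W \<I> \<and> stable_mechanism M W q \<I> \<and>
             OSP_for M W \<I> a \<and> OSP_for M W \<I> b \<and> OSP_for M W \<I> c}"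
  then obtain \<I> where \<I>: "matching_mechanism M W \<I>" "stable_mechanism M W q \<I>"
    "OSP_for M W \<I> a" "OSP_for M W \<I> b" "OSP_for M W \<I> c" by blast
  show "q \<in> {q. \<not> (\<exists>x\<in>W. \<exists>y\<in>W. \<exists>z\<in>W. cyclic_triple q a b c x y z)}"
    using cyclic_triple_not_OSP[OF \<I> _ abc(2)] profiles_distinct[OF q] by auto
qed

text \<open>The first bound fixes three men and is small when there are many women; the second fixes
  three women and is small when there are many men and \<open>k\<close> is suitable. For
  \<open>k = 0\<close> the second is the trivial bound 1, so the statement covers both
  regimes.\<close>

lemma prob_OSP_implementable:
  fixes M :: "'m set" and W :: "'w set"
  assumes fin: "finite W" "finite M" and W: "card W \<ge> 3" and M: "card M \<ge> 3" and k: "3 * k \<le> card M"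
  shows "measure_pmf.prob (random_profile W M)
      {q. \<exists>C. matching_rule M W C \<and> stable_rule M W q C \<and> OSP_implementable M W C}
    \<le> min (3 * (23 / 24) ^ card W) (9 * real k / real (card M) + (215 / 216) ^ k)"
proof -
  let ?E = "{q. \<exists>C. matching_rule M W C \<and> stable_rule M W q C \<and> OSP_implementable M W C}"
  have E: "\<not> cyclic_triple q a b c x y z"
    if q: "q \<in> profiles W M" "q \<in> ?E" and M: "{a, b, c} \<subseteq> M" and W: "{x, y, z} \<subseteq> W" for q a b c x y z
  proof
    assume cyc: "cyclic_triple q a b c x y z"
    obtain C \<I> where "stable_rule M W q C" "\<forall>p\<in>profiles M W. C p = implemented_rule \<I> p"
      and \<I>: "matching_mechanism M W \<I>" "OSP M W \<I>"
      using q(2) unfolding OSP_implementable_def by blast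
    then have "stable_mechanism M W q \<I>" by (simp add: stable_mechanism_def stable_rule_def)
    then show False
      using cyclic_triple_not_OSP[OF \<I>(1) _ _ _ _ cyc M W] \<I>(2) M W profiles_distinct[OF q(1)]
      by (simp add: OSP_def)
  qed
  obtain S where "S \<subseteq> M" "card S = 3" using M by (meson obtain_subset_with_card_n)
  then obtain a b c where abc: "distinct [a, b, c]" "{a, b, c} \<subseteq> M" by (auto simp: card_3_iff)
  obtain S' where "S' \<subseteq> W" "card S' = 3" using W by (meson obtain_subset_with_card_n)
  then obtain x y z where xyz: "distinct [x, y, z]" "{x, y, z} \<subseteq> W" by (auto simp: card_3_iff)
  have "measure_pmf.prob (random_profile W M) ?E \<le> 3 * (23 / 24) ^ card W"
  proof (rule order.trans[OF prob_random_profile_mono[OF fin] prob_no_cyclic_triple[OF fin abc]])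
    fix q assume "q \<in> profiles W M" "q \<in> ?E"
    from E[OF this abc(2)]
    show "q \<in> {q. \<not> (\<exists>x\<in>W. \<exists>y\<in>W. \<exists>z\<in>W. cyclic_triple q a b c x y z)}" by blast
  qed
  moreover have "measure_pmf.prob (random_profile W M) ?E \<le> 9 * real k / real (card M) + (215 / 216) ^ k"
  proof (rule order.trans[OF prob_random_profile_mono[OF fin] prob_no_cyclic_triple_men[OF fin xyz k]])
    fix q assume "q \<in> profiles W M" "q \<in> ?E"
    from E[OF this _ xyz(2)]
    show "q \<in> {q. \<not> (\<exists>a\<in>M. \<exists>b\<in>M. \<exists>c\<in>M. cyclic_triple q a b c x y z)}" by blast
  qed
  ultimately show ?thesis by simp
qed

text \<open>The mechanism may choose its three men depending on \<open>q\<close>, so a union bound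
  is taken over the ordered triples, of which there are at most \<open>card M ^ 3\<close>.\<close>

lemma prob_OSP_more_than_two:
  fixes M :: "'m set" and W :: "'w set"
  assumes fin: "finite W" "finite M"
  shows "measure_pmf.prob (random_profile W M)
      {q. \<exists>\<I>. matching_mechanism M W \<I> \<and> stable_mechanism M W q \<I> \<and> card {m \<in> M. OSP_for M W \<I> m} > 2}
    \<le> real (card M) ^ 3 * (3 * (23 / 24) ^ card W)"
proof -
  let ?pr = "measure_pmf.prob (random_profile W M)"
  let ?E = "\<lambda>(a, b, c). {q. \<exists>\<I>. matching_mechanism M W \<I> \<and> stable_mechanism M W q \<I> \<and>
             OSP_for M W \<I> a \<and> OSP_for M W \<I> b \<and> OSP_for M W \<I> c}"
  let ?T = "{(a, b, c). {a, b, c} \<subseteq> M \<and> distinct [a, b, c]}"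
  have T: "?T \<subseteq> M \<times> M \<times> M" by auto
  then have finT: "finite ?T" by (rule finite_subset) (simp add: fin(2))
  have cardT: "card ?T \<le> card M ^ 3"
    using card_mono[OF _ T] fin(2) by (simp add: card_cartesian_product power3_eq_cube)
  have "{q. \<exists>\<I>. matching_mechanism M W \<I> \<and> stable_mechanism M W q \<I> \<and> card {m \<in> M. OSP_for M W \<I> m} > 2}
      \<subseteq> (\<Union>t\<in>?T. ?E t)"
  proof
    fix q assume "q \<in> {q. \<exists>\<I>. matching_mechanism M W \<I> \<and> stable_mechanism M W q \<I> \<and>
      card {m \<in> M. OSP_for M W \<I> m} > 2}"
    then obtain \<I> where \<I>: "matching_mechanism M W \<I>" "stable_mechanism M W q \<I>"
      and "3 \<le> card {m \<in> M. OSP_for M W \<I> m}" by auto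
    then obtain S where "S \<subseteq> {m \<in> M. OSP_for M W \<I> m}" "card S = 3"
      by (meson obtain_subset_with_card_n)
    then obtain a b c where "distinct [a, b, c]" "{a, b, c} \<subseteq> {m \<in> M. OSP_for M W \<I> m}"
      by (auto simp: card_3_iff)
    then have "(a, b, c) \<in> ?T" "q \<in> ?E (a, b, c)" using \<I> by auto
    then show "q \<in> (\<Union>t\<in>?T. ?E t)" by (rule UN_I)
  qed
  then have "?pr {q. \<exists>\<I>. matching_mechanism M W \<I> \<and> stable_mechanism M W q \<I> \<and> card {m \<in> M. OSP_for M W \<I> m} > 2}
      \<le> ?pr (\<Union>t\<in>?T. ?E t)"
    by (intro measure_pmf.finite_measure_mono) auto
  also have "\<dots> \<le> (\<Sum>t\<in>?T. ?pr (?E t))"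
    using finT by (intro measure_pmf.finite_measure_subadditive_finite) auto
  also have "\<dots> \<le> (\<Sum>t\<in>?T. 3 * (23 / 24) ^ card W)"
    using prob_OSP_three_men[OF fin] by (intro sum_mono) auto
  also have "\<dots> = card ?T * (3 * (23 / 24) ^ card W)" by simp
  also have "\<dots> \<le> real (card M) ^ 3 * (3 * (23 / 24) ^ card W)"
    using cardT by (intro mult_right_mono) (simp_all flip: of_nat_power)
  finally show ?thesis .
qed

section \<open>Limits and the three claims\<close>

lemma poly_times_geometric_tendsto_0:
  "(\<lambda>n. poly p (real n) * (23 / 24) ^ n) \<longlonglongrightarrow> 0"
proof -
  have "(\<lambda>n. real n ^ i * (23 / 24) ^ n) \<longlonglongrightarrow> 0" for i :: nat
    by real_asymp
  then have "(\<lambda>n. \<Sum>i\<le>degree p. coeff p i * (real n ^ i * (23 / 24) ^ n)) \<longlonglongrightarrow> 0"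
    by (intro tendsto_null_sum tendsto_mult_right_zero)
  then show ?thesis by (simp add: poly_altdef sum_distrib_right mult.assoc)
qed

lemma prob_not_ge:
  "measure_pmf.prob D {q. P q} \<le> \<epsilon> \<Longrightarrow> measure_pmf.prob D {q. \<not> P q} \<ge> 1 - \<epsilon>"
  using measure_pmf.prob_compl[of "{q. P q}" D] by (simp add: Collect_neg_eq Compl_eq_Diff_UNIV)

theorem corollary1:
  shows
    "(\<forall>\<epsilon>::real. \<epsilon> > 0 \<longrightarrow> (\<exists>N::nat. \<forall>(M::'m set) (W::'w set).
        finite M \<and> finite W \<and> card M \<ge> 3 \<and> card W \<ge> 3 \<and> card M + card W \<ge> N \<longrightarrow>
        measure_pmf.prob (random_profile W M)
          {q. \<not> (\<exists>C. matching_rule M W C \<and> stable_rule M W q C \<and> OSP_implementable M W C)}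
        \<ge> 1 - \<epsilon>))
   \<and> (\<forall>\<epsilon>::real. \<epsilon> > 0 \<longrightarrow> (\<exists>N::nat. \<forall>(M::'m set) (W::'w set).
        finite M \<and> finite W \<and> card M \<ge> 3 \<and> card W \<ge> 3 \<and> card W \<ge> N \<longrightarrow>
        (\<forall>a\<in>M. \<forall>b\<in>M. \<forall>c\<in>M. a \<noteq> b \<and> a \<noteq> c \<and> b \<noteq> c \<longrightarrow>
          measure_pmf.prob (random_profile W M)
            {q. \<not> (\<exists>\<I>. matching_mechanism M W \<I> \<and> stable_mechanism M W q \<I> \<and>
                     OSP_for M W \<I> a \<and> OSP_for M W \<I> b \<and> OSP_for M W \<I> c)}
          \<ge> 1 - \<epsilon>)))
   \<and> (\<forall>(f::real poly) (\<epsilon>::real). \<epsilon> > 0 \<longrightarrow> (\<exists>N::nat. \<forall>(M::'m set) (W::'w set).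
        finite M \<and> finite W \<and> card M \<ge> 3 \<and> card W \<ge> 3 \<and>
        real (card M) \<le> poly f (real (card W)) \<and> card M + card W \<ge> N \<longrightarrow>
        measure_pmf.prob (random_profile W M)
          {q. \<not> (\<exists>\<I>. matching_mechanism M W \<I> \<and> stable_mechanism M W q \<I> \<and>
                   card {m \<in> M. OSP_for M W \<I> m} > 2)}
        \<ge> 1 - \<epsilon>))"
proof (intro conjI allI impI)
  \<comment> \<open>The polynomial will be 1 in the first two claims and \<open>f ^ 3\<close> in the
    third, where it bounds the number of triples of men.\<close>
  have ex: "\<exists>N. \<forall>n\<ge>N. 3 * (poly p (real n) * (23 / 24) ^ n) \<le> \<epsilon>" if "\<epsilon> > 0" for \<epsilon> :: real and p
  proof -
    have "(\<lambda>n. 3 * (poly p (real n) * (23 / 24) ^ n)) \<longlonglongrightarrow> 0"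
      using poly_times_geometric_tendsto_0 by (rule tendsto_mult_right_zero)
    then have "eventually (\<lambda>n. 3 * (poly p (real n) * (23 / 24) ^ n) < \<epsilon>) sequentially"
      using that by (rule order_tendstoD)
    then show ?thesis unfolding eventually_sequentially by (meson less_imp_le)
  qed
  {
    fix \<epsilon> :: real assume \<epsilon>: "\<epsilon> > 0"
    obtain N where N: "\<And>n. n \<ge> N \<Longrightarrow> 3 * (23 / 24) ^ n \<le> \<epsilon>" using ex[OF \<epsilon>, of 1] by auto
    obtain k where k: "(215 / 216 :: real) ^ k < \<epsilon> / 2"
      using real_arch_pow_inv[of "\<epsilon> / 2" "215 / 216"] \<epsilon> by auto
    \<comment> \<open>With \<open>K\<close> men there is room for \<open>k\<close> disjoint triples,
      and \<open>9 * k / card M\<close> is at most \<open>\<epsilon> / 2\<close>; the other half is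
      taken by the power of \<open>215 / 216\<close>.\<close>
    define K where "K = 3 * k + nat \<lceil>18 * k / \<epsilon>\<rceil>"
    show "\<exists>N::nat. \<forall>(M::'m set) (W::'w set).
        finite M \<and> finite W \<and> card M \<ge> 3 \<and> card W \<ge> 3 \<and> card M + card W \<ge> N \<longrightarrow>
        measure_pmf.prob (random_profile W M)
          {q. \<not> (\<exists>C. matching_rule M W C \<and> stable_rule M W q C \<and> OSP_implementable M W C)}
        \<ge> 1 - \<epsilon>"
    proof (intro exI[of _ "N + K"] allI impI prob_not_ge)
      fix M :: "'m set" and W :: "'w set"
      assume "finite M \<and> finite W \<and> card M \<ge> 3 \<and> card W \<ge> 3 \<and> card M + card W \<ge> N + K"
      then have MW: "finite W" "finite M" "card W \<ge> 3" "card M \<ge> 3" "card M + card W \<ge> N + K" by auto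
      show "measure_pmf.prob (random_profile W M)
          {q. \<exists>C. matching_rule M W C \<and> stable_rule M W q C \<and> OSP_implementable M W C} \<le> \<epsilon>"
      \<comment> \<open>A total of \<open>N + K\<close> leaves at least \<open>N\<close> women or at
        least \<open>K\<close> men.\<close>
      proof (cases "card W \<ge> N")
        case True
        then show ?thesis using prob_OSP_implementable[OF MW(1-4), of 0] N[OF True] by simp
      next
        case False
        then have "K \<le> card M" using MW(5) by linarith
        then have "3 * k \<le> card M" "18 * k / \<epsilon> \<le> card M" unfolding K_def by linarith+
        moreover from this have "9 * real k / real (card M) \<le> \<epsilon> / 2"
          using \<epsilon> MW(4) by (simp add: field_simps)
        ultimately show ?thesis using prob_OSP_implementable[OF MW(1-4), of k] k by simp
      qed
    qed
  }
  {
    fix \<epsilon> :: real assume \<epsilon>: "\<epsilon> > 0"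
    obtain N where N: "\<And>n. n \<ge> N \<Longrightarrow> 3 * (23 / 24) ^ n \<le> \<epsilon>" using ex[OF \<epsilon>, of 1] by auto
    show "\<exists>N::nat. \<forall>(M::'m set) (W::'w set).
        finite M \<and> finite W \<and> card M \<ge> 3 \<and> card W \<ge> 3 \<and> card W \<ge> N \<longrightarrow>
        (\<forall>a\<in>M. \<forall>b\<in>M. \<forall>c\<in>M. a \<noteq> b \<and> a \<noteq> c \<and> b \<noteq> c \<longrightarrow>
          measure_pmf.prob (random_profile W M)
            {q. \<not> (\<exists>\<I>. matching_mechanism M W \<I> \<and> stable_mechanism M W q \<I> \<and>
                     OSP_for M W \<I> a \<and> OSP_for M W \<I> b \<and> OSP_for M W \<I> c)}
          \<ge> 1 - \<epsilon>)"
    proof (intro exI[of _ N] allI impI ballI prob_not_ge)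
      fix M :: "'m set" and W :: "'w set" and a b c
      assume MW: "finite M \<and> finite W \<and> card M \<ge> 3 \<and> card W \<ge> 3 \<and> card W \<ge> N"
        and abc: "a \<in> M" "b \<in> M" "c \<in> M" "a \<noteq> b \<and> a \<noteq> c \<and> b \<noteq> c"
      show "measure_pmf.prob (random_profile W M)
            {q. \<exists>\<I>. matching_mechanism M W \<I> \<and> stable_mechanism M W q \<I> \<and>
                     OSP_for M W \<I> a \<and> OSP_for M W \<I> b \<and> OSP_for M W \<I> c} \<le> \<epsilon>"
        by (rule order.trans[OF prob_OSP_three_men N]) (use MW abc in auto)
    qed
  }
  {
    fix f :: "real poly" and \<epsilon> :: real assume \<epsilon>: "\<epsilon> > 0"
    obtain N where N: "\<And>n. n \<ge> N \<Longrightarrow> 3 * (poly (f ^ 3) (real n) * (23 / 24) ^ n) \<le> \<epsilon>"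
      using ex[OF \<epsilon>, of "f ^ 3"] by auto
    \<comment> \<open>The sum bounds every value of \<open>f\<close> at an argument below
      \<open>N\<close>. With fewer than \<open>N\<close> women there would thus be fewer than
      \<open>K\<close> men, so a total of \<open>N + K\<close> forces
      \<open>card W \<ge> N\<close>.\<close>
    define K where "K = Suc (nat \<lceil>\<Sum>n<N. \<bar>poly f (real n)\<bar>\<rceil>)"
    show "\<exists>N::nat. \<forall>(M::'m set) (W::'w set).
        finite M \<and> finite W \<and> card M \<ge> 3 \<and> card W \<ge> 3 \<and>
        real (card M) \<le> poly f (real (card W)) \<and> card M + card W \<ge> N \<longrightarrow>
        measure_pmf.prob (random_profile W M)
          {q. \<not> (\<exists>\<I>. matching_mechanism M W \<I> \<and> stable_mechanism M W q \<I> \<and>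
                   card {m \<in> M. OSP_for M W \<I> m} > 2)}
        \<ge> 1 - \<epsilon>"
    proof (intro exI[of _ "N + K"] allI impI prob_not_ge)
      fix M :: "'m set" and W :: "'w set"
      assume "finite M \<and> finite W \<and> card M \<ge> 3 \<and> card W \<ge> 3 \<and>
        real (card M) \<le> poly f (real (card W)) \<and> card M + card W \<ge> N + K"
      then have MW: "finite W" "finite M" "real (card M) \<le> poly f (real (card W))"
        "card M + card W \<ge> N + K" by auto
      have "card W \<ge> N"
      proof (rule ccontr)
        assume "\<not> card W \<ge> N"
        then have W: "card W < N" by simp
        then have "\<bar>poly f (real (card W))\<bar> \<le> (\<Sum>n<N. \<bar>poly f (real n)\<bar>)"
          by (intro member_le_sum[of _ _ "\<lambda>n. \<bar>poly f (real n)\<bar>"]) auto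
        then have "real (card M) \<le> (\<Sum>n<N. \<bar>poly f (real n)\<bar>)" using MW(3) by linarith
        then have "card M < K" unfolding K_def by linarith
        then show False using W MW(4) by linarith
      qed
      have "real (card M) ^ 3 * (3 * (23 / 24) ^ card W)
          \<le> poly f (real (card W)) ^ 3 * (3 * (23 / 24) ^ card W)"
        using MW(3) by (intro mult_right_mono power_mono) auto
      also have "\<dots> = 3 * (poly (f ^ 3) (real (card W)) * (23 / 24) ^ card W)" by simp
      also have "\<dots> \<le> \<epsilon>" using \<open>card W \<ge> N\<close> by (rule N)
      finally have le: "real (card M) ^ 3 * (3 * (23 / 24) ^ card W) \<le> \<epsilon>" .
      show "measure_pmf.prob (random_profile W M)
          {q. \<exists>\<I>. matching_mechanism M W \<I> \<and> stable_mechanism M W q \<I> \<and>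
                   card {m \<in> M. OSP_for M W \<I> m} > 2} \<le> \<epsilon>"
        by (rule order.trans[OF prob_OSP_more_than_two[OF MW(1,2)] le])
    qed
  }
qed

end
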